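(* Let $(M^{2m},\langle\,,\rangle,J)$ be a connected Kähler manifold of real dimension $2m$ such that the weak maximum principle for the Hessian holds on $M$. Then $M$ cannot be isometrically immersed into a non-degenerate cone of $\mathbb{R}^{3m-1}$.
   Context: The weak maximum principle for the Hessian holds on $M$ if for every $u\in C^2(M)$ with $u^*=\sup_Mu<+\infty$ there exists a sequence $\{x_k\}\subset M$ such that, for every $k\in\mathbb{N}$, $$u(x_k)>u^*-\frac1k,\qquad \sup_{v\in T_{x_k}M,\ |v|=1}\mathrm{Hess}_{x_k}u(v,v)<\frac1k.$$ A non-degenerate cone of $\mathbb{R}^n$ (with its canonical flat metric $\langle\,,\rangle$) is a set of the form $$\mathcal{C}_{o,v,\theta}=\Big\{z\in\mathbb{R}^n\setminus\{o\}:\Big\langle\frac{z-o}{|z-o|},v\Big\rangle\ge\cos(\theta)\Big\}$$ with vertex $o\in\mathbb{R}^n$, direction $v\in\mathbb{S}^{n-1}$ and width $\theta\in(0,\pi/2)$. The conclusion says that there is no isometric immersion $\varphi:M\to\mathbb{R}^{3m-1}$ (isometric with respect to the underlying Riemannian metric) with $\varphi(M)$ contained in such a cone. *)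

theory Defs
  imports "HOL-Analysis.Analysis"
begin

text \<open>
  Manifolds are given by a topology and a smooth atlas.  Maps of class \<open>C\<^sup>k\<close> are only
  considered on open sets, where the two-sided derivative \<open>at x\<close> is the right notion.
\<close>

fun C_k_on :: "nat \<Rightarrow> 'a::euclidean_space set \<Rightarrow> ('a \<Rightarrow> 'b::real_normed_vector) \<Rightarrow> bool" where
  "C_k_on 0 S f \<longleftrightarrow> continuous_on S f"
| "C_k_on (Suc k) S f \<longleftrightarrow>
     (\<forall>x\<in>S. f differentiable (at x)) \<and>
     (\<forall>b\<in>Basis. C_k_on k S (\<lambda>x. frechet_derivative f (at x) b))"

definition smooth_on :: "'a::euclidean_space set \<Rightarrow> ('a \<Rightarrow> 'b::real_normed_vector) \<Rightarrow> bool" where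
  "smooth_on S f \<longleftrightarrow> (\<forall>k. C_k_on k S f)"

text \<open>A chart is a pair of its domain and its coordinate map; the values of the coordinate map
  outside the domain are irrelevant.\<close>

type_synonym ('a, 'e) chart = "'a set \<times> ('a \<Rightarrow> 'e)"

abbreviation chart_dom :: "('a, 'e) chart \<Rightarrow> 'a set" where
  "chart_dom c \<equiv> fst c"

abbreviation chart_map :: "('a, 'e) chart \<Rightarrow> 'a \<Rightarrow> 'e" where
  "chart_map c \<equiv> snd c"

definition chart_image :: "('a, 'e) chart \<Rightarrow> 'e set" where
  "chart_image c = chart_map c ` chart_dom c"

definition chart_inv :: "('a, 'e) chart \<Rightarrow> 'e \<Rightarrow> 'a" where
  "chart_inv c = inv_into (chart_dom c) (chart_map c)"

definition transition :: "('a, 'e) chart \<Rightarrow> ('a, 'e) chart \<Rightarrow> 'e \<Rightarrow> 'e" where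
  "transition c d = chart_map d \<circ> chart_inv c"

locale smooth_manifold =
  fixes M :: "'a topology" and A :: "('a, 'e::euclidean_space) chart set"
  assumes Hausdorff: "Hausdorff_space M"
    and second_countable: "second_countable M"
    and covering: "(\<Union>c\<in>A. chart_dom c) = topspace M"
    and open_chart_dom: "c \<in> A \<Longrightarrow> openin M (chart_dom c)"
    and open_chart_image: "c \<in> A \<Longrightarrow> open (chart_image c)"
    and homeomorphic_chart: "c \<in> A \<Longrightarrow>
          homeomorphic_map (subtopology M (chart_dom c)) (top_of_set (chart_image c)) (chart_map c)"
    and smooth_transition: "c \<in> A \<Longrightarrow> d \<in> A \<Longrightarrow>
          smooth_on (chart_map c ` (chart_dom c \<inter> chart_dom d)) (transition c d)"

definition C_k_map ::
  "nat \<Rightarrow> ('a, 'e::euclidean_space) chart set \<Rightarrow> ('a \<Rightarrow> 'b::real_normed_vector) \<Rightarrow> bool" where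
  "C_k_map k A f \<longleftrightarrow> (\<forall>c\<in>A. C_k_on k (chart_image c) (f \<circ> chart_inv c))"

definition smooth_map ::
  "('a, 'e::euclidean_space) chart set \<Rightarrow> ('a \<Rightarrow> 'b::real_normed_vector) \<Rightarrow> bool" where
  "smooth_map A f \<longleftrightarrow> (\<forall>k. C_k_map k A f)"

text \<open>A tangent vector at \<open>x\<close> assigns to every chart around \<open>x\<close> the vector of its components in
  that chart, subject to the usual transformation law.  The value \<open>0\<close> for the remaining charts
  is a normalisation that makes the representation unique.\<close>

type_synonym ('a, 'e) tangent_vector = "('a, 'e) chart \<Rightarrow> 'e"

definition tangent_space ::
  "('a, 'e::euclidean_space) chart set \<Rightarrow> 'a \<Rightarrow> ('a, 'e) tangent_vector set" where
  "tangent_space A x =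
     {v. (\<forall>c\<in>A. \<forall>d\<in>A. x \<in> chart_dom c \<and> x \<in> chart_dom d \<longrightarrow>
            v d = frechet_derivative (transition c d) (at (chart_map c x)) (v c)) \<and>
         (\<forall>c. \<not> (c \<in> A \<and> x \<in> chart_dom c) \<longrightarrow> v c = 0)}"

text \<open>The tangent vector at \<open>x\<close> with components \<open>a\<close> in the chart \<open>c\<close>; as \<open>x\<close> varies this is the
  coordinate vector field with constant components \<open>a\<close>.\<close>

definition coord_vector ::
  "('a, 'e::euclidean_space) chart set \<Rightarrow> ('a, 'e) chart \<Rightarrow> 'a \<Rightarrow> 'e \<Rightarrow> ('a, 'e) tangent_vector" where
  "coord_vector A c x a =
     (\<lambda>d. if d \<in> A \<and> x \<in> chart_dom d
          then frechet_derivative (transition c d) (at (chart_map c x)) a else 0)"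

text \<open>An arbitrary chart around \<open>x\<close>.  It is only used below to evaluate expressions (the
  differential and the Hessian) that do not depend on the chart.\<close>

definition chart_at :: "('a, 'e) chart set \<Rightarrow> 'a \<Rightarrow> ('a, 'e) chart" where
  "chart_at A x = (SOME c. c \<in> A \<and> x \<in> chart_dom c)"

definition differential ::
  "('a, 'e::euclidean_space) chart set \<Rightarrow> ('a \<Rightarrow> 'b::real_normed_vector) \<Rightarrow> 'a
     \<Rightarrow> ('a, 'e) tangent_vector \<Rightarrow> 'b" where
  "differential A f x v =
     (let c = chart_at A x
      in frechet_derivative (f \<circ> chart_inv c) (at (chart_map c x)) (v c))"


type_synonym ('a, 'e) metric =
  "'a \<Rightarrow> ('a, 'e) tangent_vector \<Rightarrow> ('a, 'e) tangent_vector \<Rightarrow> real"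

definition metric_coord ::
  "('a, 'e::euclidean_space) chart set \<Rightarrow> ('a, 'e) metric \<Rightarrow> ('a, 'e) chart
     \<Rightarrow> 'e \<Rightarrow> 'e \<Rightarrow> 'e \<Rightarrow> real" where
  "metric_coord A g c y a b =
     (let x = chart_inv c y in g x (coord_vector A c x a) (coord_vector A c x b))"

locale riemannian_manifold = smooth_manifold M A
  for M :: "'a topology" and A :: "('a, 'e::euclidean_space) chart set" +
  fixes g :: "('a, 'e) metric"
  assumes metric_linear: "\<lbrakk>x \<in> topspace M; u \<in> tangent_space A x; v \<in> tangent_space A x;
            w \<in> tangent_space A x\<rbrakk>
          \<Longrightarrow> g x (\<lambda>c. r *\<^sub>R u c + s *\<^sub>R v c) w = r * g x u w + s * g x v w"
    and metric_sym: "\<lbrakk>x \<in> topspace M; v \<in> tangent_space A x; w \<in> tangent_space A x\<rbrakk>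
          \<Longrightarrow> g x v w = g x w v"
    and metric_pos: "\<lbrakk>x \<in> topspace M; v \<in> tangent_space A x; v \<noteq> (\<lambda>_. 0)\<rbrakk> \<Longrightarrow> g x v v > 0"
    and metric_smooth: "c \<in> A \<Longrightarrow> smooth_on (chart_image c) (\<lambda>y. metric_coord A g c y a b)"

text \<open>The components of \<open>\<nabla>\<^sub>a b\<close> for the Levi-Civita connection and the coordinate vector fields with
  constant components \<open>a\<close> and \<open>b\<close>, determined by the Koszul formula (the Lie brackets of such
  fields vanish).\<close>

definition christoffel ::
  "('a, 'e::euclidean_space) chart set \<Rightarrow> ('a, 'e) metric \<Rightarrow> ('a, 'e) chart
     \<Rightarrow> 'e \<Rightarrow> 'e \<Rightarrow> 'e \<Rightarrow> 'e" where
  "christoffel A g c y a b =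
     (THE z. \<forall>w. 2 * metric_coord A g c y z w =
          frechet_derivative (\<lambda>y. metric_coord A g c y b w) (at y) a
        + frechet_derivative (\<lambda>y. metric_coord A g c y a w) (at y) b
        - frechet_derivative (\<lambda>y. metric_coord A g c y a b) (at y) w)"

text \<open>\<open>Hess u(a, b) = a(b(u)) - (\<nabla>\<^sub>a b)(u)\<close> in the chart \<open>c\<close>.\<close>

definition hessian_coord ::
  "('a, 'e::euclidean_space) chart set \<Rightarrow> ('a, 'e) metric \<Rightarrow> ('a, 'e) chart
     \<Rightarrow> ('a \<Rightarrow> real) \<Rightarrow> 'e \<Rightarrow> 'e \<Rightarrow> 'e \<Rightarrow> real" where
  "hessian_coord A g c u y a b =
       frechet_derivative (\<lambda>z. frechet_derivative (u \<circ> chart_inv c) (at z) b) (at y) a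
     - frechet_derivative (u \<circ> chart_inv c) (at y) (christoffel A g c y a b)"

definition hessian ::
  "('a, 'e::euclidean_space) chart set \<Rightarrow> ('a, 'e) metric \<Rightarrow> ('a \<Rightarrow> real) \<Rightarrow> 'a
     \<Rightarrow> ('a, 'e) tangent_vector \<Rightarrow> ('a, 'e) tangent_vector \<Rightarrow> real" where
  "hessian A g u x v w =
     (let c = chart_at A x in hessian_coord A g c u (chart_map c x) (v c) (w c))"

text \<open>The condition \<open>k \<ge> 1\<close> is needed because \<open>1 / 0 = 0\<close> in HOL.\<close>

definition weak_maximum_principle_hessian ::
  "'a topology \<Rightarrow> ('a, 'e::euclidean_space) chart set \<Rightarrow> ('a, 'e) metric \<Rightarrow> bool" where
  "weak_maximum_principle_hessian M A g \<longleftrightarrow>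
     (\<forall>u :: 'a \<Rightarrow> real. C_k_map 2 A u \<and> bdd_above (u ` topspace M) \<longrightarrow>
        (\<exists>x :: nat \<Rightarrow> 'a. (\<forall>k. x k \<in> topspace M) \<and>
           (\<forall>k\<ge>1. u (x k) > (SUP p\<in>topspace M. u p) - 1 / real k \<and>
              (SUP v\<in>{v \<in> tangent_space A (x k). sqrt (g (x k) v v) = 1}.
                 ereal (hessian A g u (x k) v v)) < ereal (1 / real k))))"


type_synonym ('a, 'e) endomorphism_field =
  "'a \<Rightarrow> ('a, 'e) tangent_vector \<Rightarrow> ('a, 'e) tangent_vector"

definition endo_coord ::
  "('a, 'e::euclidean_space) chart set \<Rightarrow> ('a, 'e) endomorphism_field \<Rightarrow> ('a, 'e) chart
     \<Rightarrow> 'e \<Rightarrow> 'e \<Rightarrow> 'e" where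
  "endo_coord A J c y a = (let x = chart_inv c y in J x (coord_vector A c x a) c)"

text \<open>\<open>(\<nabla>\<^sub>a J) b = \<nabla>\<^sub>a (J b) - J (\<nabla>\<^sub>a b)\<close> in the chart \<open>c\<close>.\<close>

definition nabla_endo_coord ::
  "('a, 'e::euclidean_space) chart set \<Rightarrow> ('a, 'e) metric \<Rightarrow> ('a, 'e) endomorphism_field
     \<Rightarrow> ('a, 'e) chart \<Rightarrow> 'e \<Rightarrow> 'e \<Rightarrow> 'e \<Rightarrow> 'e" where
  "nabla_endo_coord A g J c y a b =
       frechet_derivative (\<lambda>z. endo_coord A J c z b) (at y) a
     + christoffel A g c y a (endo_coord A J c y b)
     - endo_coord A J c y (christoffel A g c y a b)"

text \<open>A Kaehler structure is an orthogonal almost complex structure that is parallel for the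
  Levi-Civita connection; integrability of \<open>J\<close> and closedness of the Kaehler form follow.\<close>

locale kaehler_manifold = riemannian_manifold M A g
  for M :: "'a topology" and A :: "('a, 'e::euclidean_space) chart set" and g +
  fixes J :: "('a, 'e) endomorphism_field"
  assumes J_tangent: "\<lbrakk>x \<in> topspace M; v \<in> tangent_space A x\<rbrakk> \<Longrightarrow> J x v \<in> tangent_space A x"
    and J_linear: "\<lbrakk>x \<in> topspace M; v \<in> tangent_space A x; w \<in> tangent_space A x\<rbrakk>
          \<Longrightarrow> J x (\<lambda>c. r *\<^sub>R v c + s *\<^sub>R w c) = (\<lambda>c. r *\<^sub>R J x v c + s *\<^sub>R J x w c)"
    and J_square: "\<lbrakk>x \<in> topspace M; v \<in> tangent_space A x\<rbrakk> \<Longrightarrow> J x (J x v) = (\<lambda>c. - v c)"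
    and J_smooth: "c \<in> A \<Longrightarrow> smooth_on (chart_image c) (\<lambda>y. endo_coord A J c y a)"
    and J_orthogonal: "\<lbrakk>x \<in> topspace M; v \<in> tangent_space A x; w \<in> tangent_space A x\<rbrakk>
          \<Longrightarrow> g x (J x v) (J x w) = g x v w"
    and J_parallel: "\<lbrakk>c \<in> A; y \<in> chart_image c\<rbrakk> \<Longrightarrow> nabla_endo_coord A g J c y a b = 0"


definition immersion ::
  "'a topology \<Rightarrow> ('a, 'e::euclidean_space) chart set \<Rightarrow> ('a \<Rightarrow> 'f::euclidean_space) \<Rightarrow> bool" where
  "immersion M A \<phi> \<longleftrightarrow> smooth_map A \<phi> \<and>
     (\<forall>x\<in>topspace M. inj_on (differential A \<phi> x) (tangent_space A x))"

definition isometric_immersion ::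
  "'a topology \<Rightarrow> ('a, 'e::euclidean_space) chart set \<Rightarrow> ('a, 'e) metric
     \<Rightarrow> ('a \<Rightarrow> 'f::euclidean_space) \<Rightarrow> bool" where
  "isometric_immersion M A g \<phi> \<longleftrightarrow> immersion M A \<phi> \<and>
     (\<forall>x\<in>topspace M. \<forall>v\<in>tangent_space A x. \<forall>w\<in>tangent_space A x.
        differential A \<phi> x v \<bullet> differential A \<phi> x w = g x v w)"

definition cone :: "'f::euclidean_space \<Rightarrow> 'f \<Rightarrow> real \<Rightarrow> 'f set" where
  "cone p v \<theta> = {z. z \<noteq> p \<and> ((z - p) /\<^sub>R norm (z - p)) \<bullet> v \<ge> cos \<theta>}"

definition nondegenerate_cone :: "'f::euclidean_space set \<Rightarrow> bool" where
  "nondegenerate_cone C \<longleftrightarrow> (\<exists>p v \<theta>. norm v = 1 \<and> 0 < \<theta> \<and> \<theta> < pi / 2 \<and> C = cone p v \<theta>)"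

end

theory Submission
  imports Defs
begin

text \<open>
  With \<open>\<kappa> = cos \<theta>\<close> and the vertex of the cone at the origin, the function
  \<open>u = sqrt (T\<^sup>2 + \<kappa>\<^sup>2 |\<phi>|\<^sup>2) - \<langle>\<phi>, v\<rangle>\<close> is at most \<open>T\<^sup>2 / sqrt (T\<^sup>2 + \<kappa>\<^sup>2 |\<phi>|\<^sup>2)\<close> on
  the cone, and for large \<open>T\<close> its supremum is positive.  Hence \<open>\<phi>\<close> stays bounded along the
  sequence given by the weak maximum principle, where the Euclidean Hessian of the function is
  uniformly positive.  Since
  \<open>Hess u (X, X)\<close> is the Euclidean Hessian plus the normal part of the gradient paired with the
  second fundamental form \<open>\<alpha>(X, X)\<close>, it suffices to find at every point some \<open>X \<noteq> 0\<close> with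
  \<open>\<alpha>(X, X) + \<alpha>(J X, J X) = 0\<close>: then one of \<open>X\<close> and \<open>J X\<close> contradicts the Hessian bound.

  Such an \<open>X\<close> exists by an argument in the style of Otsuki's lemma.  Put
  \<open>\<beta>(X, Y) = \<alpha>(X, Y) + \<alpha>(J X, J Y)\<close>.  The Gauss equation and the Kaehler identities give
  \<open>\<langle>\<beta>(X, X), \<beta>(Y, Y)\<rangle> = |\<beta>(X, Y)|\<^sup>2 + |\<beta>(X, J Y)|\<^sup>2\<close>.  Since the codimension \<open>m - 1\<close> is less than
  \<open>m\<close>, there is for every \<open>X\<close> some \<open>Y \<noteq> 0\<close> with \<open>\<beta>(X, Y) = \<beta>(X, J Y) = 0\<close>, whence
  \<open>|\<beta>(X + t Y, X + t Y)|\<^sup>2 = |\<beta>(X, X)|\<^sup>2 + O(t\<^sup>4)\<close>.  This is impossible if \<open>X\<close> minimizes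
  \<open>|\<beta>(X, X)|\<^sup>2\<close> on the unit sphere and the minimum is not \<open>0\<close>.
\<close>

section \<open>Maps of class \<open>C\<^sup>k\<close> and mixed derivatives\<close>

text \<open>Openness of \<open>S\<close> makes the two-sided derivatives depend only on the values
  on \<open>S\<close>, so the induction can pass to partial derivatives.\<close>

lemma C_k_on_cong:
  assumes "open S" "\<And>x. x \<in> S \<Longrightarrow> f x = g x"
  shows "C_k_on k S f \<longleftrightarrow> C_k_on k S g"
  using assms(2)
proof (induction k arbitrary: f g)
  case (Suc k)
  have "f differentiable (at x) \<longleftrightarrow> g differentiable (at x)" if "x \<in> S" for x
    using that Suc.prems assms(1)
    unfolding differentiable_def
    using has_derivative_transform_within_open[of f _ x UNIV S g]
      has_derivative_transform_within_open[of g _ x UNIV S f] by auto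
  moreover have "frechet_derivative f (at x) = frechet_derivative g (at x)"
    if "x \<in> S" "f differentiable (at x)" for x
    using frechet_derivative_transform_within_open that Suc.prems assms(1) by blast
  ultimately show ?case
    using Suc.IH[of "\<lambda>x. frechet_derivative f (at x) b" "\<lambda>x. frechet_derivative g (at x) b" for b]
    by auto
qed auto

lemma frechet_derivative_unique:
  "(f has_derivative f') (at x) \<Longrightarrow> frechet_derivative f (at x) = f'"
  using frechet_derivative_at by metis

lemma C_k_on_Suc_continuous: "C_k_on (Suc k) S f \<Longrightarrow> continuous_on S f"
  using differentiable_imp_continuous_within[of f _ UNIV] by (simp add: continuous_at_imp_continuous_on)

lemma C_k_on_SucD: "C_k_on (Suc k) S f \<Longrightarrow> C_k_on k S f"
proof (induction k arbitrary: f)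
  case 0
  then show ?case
    unfolding C_k_on.simps(1) by (rule C_k_on_Suc_continuous)
next
  case (Suc k)
  then show ?case
    by (metis C_k_on.simps(2))
qed

lemma C_k_on_SucI:
  assumes "open S"
    and "\<And>x. x \<in> S \<Longrightarrow> (f has_derivative f' x) (at x)"
    and "\<And>b. b \<in> Basis \<Longrightarrow> C_k_on k S (\<lambda>x. f' x b)"
  shows "C_k_on (Suc k) S f"
proof -
  have "C_k_on k S (\<lambda>x. frechet_derivative f (at x) b)" if "b \<in> Basis" for b
    using assms(3)[OF that] assms(1,2)
    by (subst C_k_on_cong[of S _ "\<lambda>x. f' x b"]) (auto simp: frechet_derivative_unique[OF assms(2)])
  then show ?thesis
    using assms(2) by (auto simp: differentiable_def)
qed

lemma C_k_on_add:
  assumes "open S" "C_k_on k S f" "C_k_on k S g"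
  shows "C_k_on k S (\<lambda>x. f x + g x)"
  using assms(2,3)
proof (induction k arbitrary: f g)
  case (Suc k)
  show ?case
  proof (rule C_k_on_SucI[OF assms(1)])
    show "((\<lambda>x. f x + g x) has_derivative
        (\<lambda>h. frechet_derivative f (at x) h + frechet_derivative g (at x) h)) (at x)"
      if "x \<in> S" for x
      using Suc.prems that
      by (intro has_derivative_add) (auto simp: frechet_derivative_works[symmetric])
    show "C_k_on k S (\<lambda>x. frechet_derivative f (at x) b + frechet_derivative g (at x) b)"
      if "b \<in> Basis" for b
      using Suc that by auto
  qed
qed (auto intro: continuous_on_add)

text \<open>Leibniz rule: each summand of the derivative keeps one factor undifferentiated, whose
  order is lowered by \<open>C_k_on_SucD\<close>.\<close>

lemma (in bounded_bilinear) C_k_on_bilinear: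
  assumes "open S" "C_k_on k S f" "C_k_on k S g"
  shows "C_k_on k S (\<lambda>x. prod (f x) (g x))"
  using assms(2,3)
proof (induction k arbitrary: f g)
  case (Suc k)
  show ?case
  proof (rule C_k_on_SucI[OF assms(1)])
    show "((\<lambda>x. prod (f x) (g x)) has_derivative
        (\<lambda>h. prod (f x) (frechet_derivative g (at x) h) + prod (frechet_derivative f (at x) h) (g x))) (at x)"
      if "x \<in> S" for x
      using Suc.prems that
      by (intro FDERIV) (auto simp: frechet_derivative_works[symmetric])
    show "C_k_on k S (\<lambda>x. prod (f x) (frechet_derivative g (at x) b) + prod (frechet_derivative f (at x) b) (g x))"
      if "b \<in> Basis" for b
      using Suc that C_k_on_SucD[OF Suc.prems(1)] C_k_on_SucD[OF Suc.prems(2)]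
      by (intro C_k_on_add assms(1) Suc.IH) auto
  qed
qed (auto intro: continuous_on)

lemma C_k_on_const: "C_k_on k S (\<lambda>x. c)"
  by (induction k arbitrary: c) auto

lemma C_k_on_sum:
  assumes "open S" "\<And>i. i \<in> I \<Longrightarrow> C_k_on k S (f i)"
  shows "C_k_on k S (\<lambda>x. \<Sum>i\<in>I. f i x)"
  using assms(2)
  by (induction I rule: infinite_finite_induct) (auto intro: C_k_on_const C_k_on_add[OF assms(1)])

lemma linear_basis_expansion:
  fixes f :: "'e::euclidean_space \<Rightarrow> 'f::real_vector"
  assumes "linear f"
  shows "(\<Sum>i\<in>Basis. (b \<bullet> i) *\<^sub>R f i) = f b"
proof -
  have "(\<Sum>i\<in>Basis. (b \<bullet> i) *\<^sub>R f i) = f (\<Sum>i\<in>Basis. (b \<bullet> i) *\<^sub>R i)"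
    by (simp add: linear_sum[OF assms] linear_scale[OF assms])
  then show ?thesis
    by (simp add: euclidean_representation)
qed

text \<open>The recursion tests only basis directions; any other direction is a constant linear
  combination of them.\<close>

lemma C_k_on_frechet_derivative:
  assumes "open S" "C_k_on (Suc k) S f"
  shows "C_k_on k S (\<lambda>x. frechet_derivative f (at x) v)"
proof -
  have "C_k_on k S (\<lambda>x. \<Sum>b\<in>Basis. (v \<bullet> b) *\<^sub>R frechet_derivative f (at x) b)"
    using assms
    by (intro C_k_on_sum bounded_bilinear.C_k_on_bilinear[OF bounded_bilinear_scaleR] C_k_on_const) auto
  moreover have "frechet_derivative f (at x) v = (\<Sum>b\<in>Basis. (v \<bullet> b) *\<^sub>R frechet_derivative f (at x) b)"
    if "x \<in> S" for x
    using assms(2) that by (simp add: linear_basis_expansion linear_frechet_derivative)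
  ultimately show ?thesis
    by (subst C_k_on_cong[OF assms(1)])
qed

lemma smooth_on_frechet_derivative:
  "open S \<Longrightarrow> smooth_on S f \<Longrightarrow> smooth_on S (\<lambda>x. frechet_derivative f (at x) v)"
  unfolding smooth_on_def using C_k_on_frechet_derivative by blast

lemma smooth_on_has_derivative:
  assumes "smooth_on S f" "x \<in> S"
  shows "(f has_derivative frechet_derivative f (at x)) (at x)"
proof -
  have "C_k_on (Suc 0) S f"
    using assms(1) unfolding smooth_on_def by blast
  then show ?thesis
    using assms(2) by (auto simp: frechet_derivative_works[symmetric])
qed

lemma smooth_on_continuous_on: "smooth_on S f \<Longrightarrow> continuous_on S f"
  unfolding smooth_on_def using C_k_on.simps(1) by blast

text \<open>Both mixed derivatives are the limit of the second difference quotient; two applications of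
  the mean value theorem produce the intermediate points.\<close>

lemma second_difference_mvt:
  fixes f :: "'e::euclidean_space \<Rightarrow> real"
  assumes fa: "\<And>\<sigma> \<tau>. 0 \<le> \<sigma> \<Longrightarrow> \<sigma> \<le> t \<Longrightarrow> 0 \<le> \<tau> \<Longrightarrow> \<tau> \<le> t \<Longrightarrow>
      (f has_derivative f' (x + \<sigma> *\<^sub>R a + \<tau> *\<^sub>R b)) (at (x + \<sigma> *\<^sub>R a + \<tau> *\<^sub>R b))"
    and fab: "\<And>\<sigma> \<tau>. 0 \<le> \<sigma> \<Longrightarrow> \<sigma> \<le> t \<Longrightarrow> 0 \<le> \<tau> \<Longrightarrow> \<tau> \<le> t \<Longrightarrow>
      ((\<lambda>z. f' z a) has_derivative f'' (x + \<sigma> *\<^sub>R a + \<tau> *\<^sub>R b)) (at (x + \<sigma> *\<^sub>R a + \<tau> *\<^sub>R b))"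
    and "t > 0"
  obtains \<sigma> \<tau> where "0 < \<sigma>" "\<sigma> < t" "0 < \<tau>" "\<tau> < t"
    "f (x + t *\<^sub>R a + t *\<^sub>R b) - f (x + t *\<^sub>R a) - f (x + t *\<^sub>R b) + f x
      = t * t * f'' (x + \<sigma> *\<^sub>R a + \<tau> *\<^sub>R b) b"
proof -
  \<comment> \<open>The increment in direction \<open>b\<close>, moved along \<open>a\<close>. The
    term \<open>0 *\<^sub>R b\<close> gives both points the shape used in the hypotheses.\<close>
  define h where "h \<sigma> = f (x + \<sigma> *\<^sub>R a + t *\<^sub>R b) - f (x + \<sigma> *\<^sub>R a + 0 *\<^sub>R b)" for \<sigma> :: real
  have line: "((\<lambda>\<sigma>. x + \<sigma> *\<^sub>R a + \<tau> *\<^sub>R b) has_derivative (\<lambda>s. s *\<^sub>R a)) (at \<sigma> within T)" for \<sigma> \<tau> :: real and T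
    by (auto intro!: derivative_eq_intros)
  have line2: "((\<lambda>\<tau>. x + \<sigma> *\<^sub>R a + \<tau> *\<^sub>R b) has_derivative (\<lambda>s. s *\<^sub>R b)) (at \<tau> within T)" for \<sigma> \<tau> :: real and T
    by (auto intro!: derivative_eq_intros)
  have "(h has_derivative (\<lambda>s. f' (x + \<sigma> *\<^sub>R a + t *\<^sub>R b) (s *\<^sub>R a)
      - f' (x + \<sigma> *\<^sub>R a + 0 *\<^sub>R b) (s *\<^sub>R a))) (at \<sigma> within {0..t})" if "0 \<le> \<sigma>" "\<sigma> \<le> t" for \<sigma>
    unfolding h_def
    by (rule has_derivative_diff; rule has_derivative_compose[OF line fa])
      (use that \<open>t > 0\<close> in auto)
  from mvt_simple[OF \<open>t > 0\<close> this] obtain \<sigma> where \<sigma>: "0 < \<sigma>" "\<sigma> < t"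
    and h: "h t - h 0 = f' (x + \<sigma> *\<^sub>R a + t *\<^sub>R b) (t *\<^sub>R a) - f' (x + \<sigma> *\<^sub>R a + 0 *\<^sub>R b) (t *\<^sub>R a)"
    by auto
  have lin: "f' (x + \<sigma> *\<^sub>R a + \<tau> *\<^sub>R b) (t *\<^sub>R a) = t * f' (x + \<sigma> *\<^sub>R a + \<tau> *\<^sub>R b) a"
    if "0 \<le> \<tau>" "\<tau> \<le> t" for \<tau>
    using linear_scale[OF has_derivative_linear[OF fa]] that \<sigma> by simp
  have "((\<lambda>\<tau>. f' (x + \<sigma> *\<^sub>R a + \<tau> *\<^sub>R b) a) has_derivative
      (\<lambda>s. f'' (x + \<sigma> *\<^sub>R a + \<tau> *\<^sub>R b) (s *\<^sub>R b))) (at \<tau> within {0..t})" if "0 \<le> \<tau>" "\<tau> \<le> t" for \<tau>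
    by (rule has_derivative_compose[OF line2 fab]) (use that \<sigma> in auto)
  from mvt_simple[OF \<open>t > 0\<close> this] obtain \<tau> where \<tau>: "0 < \<tau>" "\<tau> < t"
    and "f' (x + \<sigma> *\<^sub>R a + t *\<^sub>R b) a - f' (x + \<sigma> *\<^sub>R a + 0 *\<^sub>R b) a
      = f'' (x + \<sigma> *\<^sub>R a + \<tau> *\<^sub>R b) (t *\<^sub>R b)"
    by auto
  moreover have "f'' (x + \<sigma> *\<^sub>R a + \<tau> *\<^sub>R b) (t *\<^sub>R b) = t * f'' (x + \<sigma> *\<^sub>R a + \<tau> *\<^sub>R b) b"
    using linear_scale[OF has_derivative_linear[OF fab]] \<tau> \<sigma> by simp
  ultimately have "h t - h 0 = t * (t * f'' (x + \<sigma> *\<^sub>R a + \<tau> *\<^sub>R b) b)"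
    using h lin[of t] lin[of 0] \<open>t > 0\<close> by (simp add: right_diff_distrib[symmetric])
  then show thesis
    using that[OF \<sigma> \<tau>] by (simp add: h_def)
qed

lemma second_derivative_symmetric_real:
  fixes f :: "'e::euclidean_space \<Rightarrow> real"
  assumes "open S" "x \<in> S"
    and f': "\<And>z. z \<in> S \<Longrightarrow> (f has_derivative f' z) (at z)"
    and fa: "\<And>z. z \<in> S \<Longrightarrow> ((\<lambda>z. f' z a) has_derivative fa z) (at z)"
    and fb: "\<And>z. z \<in> S \<Longrightarrow> ((\<lambda>z. f' z b) has_derivative fb z) (at z)"
    and cont: "continuous_on S (\<lambda>z. fa z b)" "continuous_on S (\<lambda>z. fb z a)"
  shows "fa x b = fb x a"
proof -
  obtain r where r: "r > 0" "ball x r \<subseteq> S"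
    using assms(1,2) open_contains_ball by blast
  \<comment> \<open>In every neighbourhood of \<open>x\<close> the two mixed derivatives share a
    value, possibly at different points, because the second difference is symmetric in
    \<open>a\<close> and \<open>b\<close>.\<close>
  have close: "\<exists>z w. dist z x < e \<and> dist w x < e \<and> z \<in> S \<and> w \<in> S \<and> fa z b = fb w a" if "e > 0" for e
  proof -
    define e' where "e' = min e r"
    \<comment> \<open>The parallelogram with sides \<open>t *\<^sub>R a\<close> and
      \<open>t *\<^sub>R b\<close> stays within \<open>e'\<close> of \<open>x\<close>; the summand 1
      covers \<open>a = b = 0\<close>.\<close>
    define t where "t = e' / (norm a + norm b + 1)"
    have e': "e' > 0"
      using that r by (simp add: e'_def)
    then have t: "t > 0"
      by (simp add: t_def add_nonneg_pos)
    have near: "dist (x + \<sigma> *\<^sub>R a + \<tau> *\<^sub>R b) x < e'" if "0 \<le> \<sigma>" "\<sigma> \<le> t" "0 \<le> \<tau>" "\<tau> \<le> t" for \<sigma> \<tau>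
    proof -
      have "norm (\<sigma> *\<^sub>R a + \<tau> *\<^sub>R b) \<le> \<sigma> * norm a + \<tau> * norm b"
        using norm_triangle_ineq[of "\<sigma> *\<^sub>R a" "\<tau> *\<^sub>R b"] that by simp
      also have "\<dots> \<le> t * norm a + t * norm b"
        using that by (intro add_mono mult_right_mono) auto
      also have "\<dots> < t * (norm a + norm b + 1)"
        using t by (simp add: algebra_simps)
      also have "\<dots> = e'"
        using norm_ge_zero[of a] norm_ge_zero[of b] unfolding t_def
        by (intro nonzero_eq_divide_eq[THEN iffD1]) (linarith, simp)
      finally show ?thesis
        by (simp add: dist_norm add.assoc)
    qed
    then have inS: "x + \<sigma> *\<^sub>R a + \<tau> *\<^sub>R b \<in> S" if "0 \<le> \<sigma>" "\<sigma> \<le> t" "0 \<le> \<tau>" "\<tau> \<le> t" for \<sigma> \<tau>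
      using that r(2) near[OF that] unfolding e'_def by (auto simp: dist_commute subset_iff)
    have inS': "x + \<sigma> *\<^sub>R b + \<tau> *\<^sub>R a \<in> S" if "0 \<le> \<sigma>" "\<sigma> \<le> t" "0 \<le> \<tau>" "\<tau> \<le> t" for \<sigma> \<tau>
      using inS[of \<tau> \<sigma>] that by (simp add: ac_simps)
    obtain \<sigma> \<tau> where 1: "0 < \<sigma>" "\<sigma> < t" "0 < \<tau>" "\<tau> < t"
      "f (x + t *\<^sub>R a + t *\<^sub>R b) - f (x + t *\<^sub>R a) - f (x + t *\<^sub>R b) + f x
        = t * t * fa (x + \<sigma> *\<^sub>R a + \<tau> *\<^sub>R b) b"
      by (rule second_difference_mvt[of t f f' x a b fa]) (use t f' fa inS in auto)
    obtain \<sigma>' \<tau>' where 2: "0 < \<sigma>'" "\<sigma>' < t" "0 < \<tau>'" "\<tau>' < t"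
      "f (x + t *\<^sub>R b + t *\<^sub>R a) - f (x + t *\<^sub>R b) - f (x + t *\<^sub>R a) + f x
        = t * t * fb (x + \<sigma>' *\<^sub>R b + \<tau>' *\<^sub>R a) a"
      by (rule second_difference_mvt[of t f f' x b a fb]) (use t f' fb inS' in auto)
    have "t * t * fa (x + \<sigma> *\<^sub>R a + \<tau> *\<^sub>R b) b = t * t * fb (x + \<sigma>' *\<^sub>R b + \<tau>' *\<^sub>R a) a"
      using 1(5) 2(5) unfolding add.assoc add.commute[of "t *\<^sub>R b" "t *\<^sub>R a"] by linarith
    then have "fa (x + \<sigma> *\<^sub>R a + \<tau> *\<^sub>R b) b = fb (x + \<sigma>' *\<^sub>R b + \<tau>' *\<^sub>R a) a"
      using t by simp
    moreover have "dist (x + \<sigma> *\<^sub>R a + \<tau> *\<^sub>R b) x < e" "dist (x + \<sigma>' *\<^sub>R b + \<tau>' *\<^sub>R a) x < e"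
      using near[of \<sigma> \<tau>] near[of \<tau>' \<sigma>'] 1 2 unfolding e'_def by (auto simp: ac_simps)
    ultimately show ?thesis
      using inS[of \<sigma> \<tau>] inS'[of \<sigma>' \<tau>'] 1 2 by (intro exI conjI) auto
  qed
  show ?thesis
  proof (rule ccontr)
    assume ne: "fa x b \<noteq> fb x a"
    define e where "e = \<bar>fa x b - fb x a\<bar> / 2"
    have e: "e > 0"
      using ne by (simp add: e_def)
    obtain d1 where d1: "d1 > 0" "\<And>z. z \<in> S \<Longrightarrow> dist z x < d1 \<Longrightarrow> dist (fa z b) (fa x b) < e"
      using cont(1) e assms(2) unfolding continuous_on_iff by blast
    obtain d2 where d2: "d2 > 0" "\<And>z. z \<in> S \<Longrightarrow> dist z x < d2 \<Longrightarrow> dist (fb z a) (fb x a) < e"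
      using cont(2) e assms(2) unfolding continuous_on_iff by blast
    obtain z w where "dist z x < min d1 d2" "dist w x < min d1 d2" "z \<in> S" "w \<in> S" "fa z b = fb w a"
      using close[of "min d1 d2"] d1(1) d2(1) by auto
    then show False
      using d1(2)[of z] d2(2)[of w] unfolding e_def dist_real_def by (smt (verit) field_sum_of_halves)
  qed
qed

lemma second_derivative_symmetric:
  fixes f :: "'e::euclidean_space \<Rightarrow> 'f::euclidean_space"
  assumes "open S" "x \<in> S" "smooth_on S f"
  shows "frechet_derivative (\<lambda>z. frechet_derivative f (at z) a) (at x) b
       = frechet_derivative (\<lambda>z. frechet_derivative f (at z) b) (at x) a"
proof (rule euclidean_eqI)
  fix e :: 'f
  let ?D = "\<lambda>c z. frechet_derivative (\<lambda>z. frechet_derivative f (at z) c) (at z)"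
  note sm = smooth_on_frechet_derivative[OF assms(1)]
  show "?D a x b \<bullet> e = ?D b x a \<bullet> e"
  proof (rule second_derivative_symmetric_real[OF assms(1,2),
        where f = "\<lambda>z. f z \<bullet> e" and f' = "\<lambda>z h. frechet_derivative f (at z) h \<bullet> e"
          and fa = "\<lambda>z h. ?D a z h \<bullet> e" and fb = "\<lambda>z h. ?D b z h \<bullet> e"])
    show "continuous_on S (\<lambda>z. ?D a z b \<bullet> e)" "continuous_on S (\<lambda>z. ?D b z a \<bullet> e)"
      by (intro continuous_on_inner continuous_on_const smooth_on_continuous_on sm assms(3))+
  qed (intro has_derivative_inner_left smooth_on_has_derivative[of S] sm assms(3); assumption)+
qed

section \<open>Flat bilinear maps on complex vector spaces\<close>

text \<open>\<open>X\<close> minimizes the quartic \<open>f\<close> on the unit sphere. For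
  \<open>Y\<close> as in the conclusion, \<open>f (X + t *\<^sub>R Y)\<close> exceeds
  \<open>f X\<close> only by order \<open>t^4\<close>. With the sign of \<open>Y\<close> chosen
  suitably, \<open>norm (X + t *\<^sub>R Y) ^ 4\<close> exceeds 1 by order at least
  \<open>t^2\<close>, which for \<open>Y \<noteq> 0\<close> contradicts minimality.\<close>

lemma bilinear_anisotropic_pair:
  fixes \<beta> :: "'e::euclidean_space \<Rightarrow> 'e \<Rightarrow> 'f::euclidean_space"
  assumes bil: "bilinear \<beta>" and sym: "\<And>X Y. \<beta> X Y = \<beta> Y X"
    and anisotropic: "\<And>X. X \<noteq> 0 \<Longrightarrow> \<beta> X X \<noteq> 0"
  obtains X where "X \<noteq> 0" "\<And>Y. \<beta> X Y = 0 \<Longrightarrow> \<beta> X X \<bullet> \<beta> Y Y = 0 \<Longrightarrow> Y = 0"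
proof -
  define f where "f X = \<beta> X X \<bullet> \<beta> X X" for X
  interpret \<beta>: bounded_bilinear \<beta>
    using bil bilinear_conv_bounded_bilinear by blast
  have cont: "continuous_on (sphere 0 1) f"
    unfolding f_def by (intro continuous_intros \<beta>.continuous_on)
  have "sphere (0::'e) 1 \<noteq> {}"
    by auto
  then obtain X where X: "X \<in> sphere 0 1" "\<And>Y. Y \<in> sphere 0 1 \<Longrightarrow> f X \<le> f Y"
    using continuous_attains_inf[OF compact_sphere _ cont] by blast
  have X1: "norm X = 1" and X0: "X \<noteq> 0"
    using X(1) by auto
  have hom: "f (r *\<^sub>R Z) = r ^ 4 * f Z" for r Z
    by (simp add: f_def \<beta>.scaleR_left \<beta>.scaleR_right power4_eq_xxxx)
  have min: "f X * norm Z ^ 4 \<le> f Z" for Z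
  proof (cases "Z = 0")
    case False
    then have "f X \<le> f (inverse (norm Z) *\<^sub>R Z)"
      by (intro X(2)) simp
    also have "\<dots> = f Z / norm Z ^ 4"
      unfolding hom by (simp add: field_simps)
    finally show ?thesis
      using False by (simp add: field_simps)
  qed (simp add: f_def)
  have fX: "f X > 0"
    using anisotropic[OF X0] by (simp add: f_def)
  \<comment> \<open>The sign condition makes the cross term of
    \<open>(norm (X + t *\<^sub>R Y))\<^sup>2\<close> nonnegative; the other sign is reached through
    \<open>- Y\<close>.\<close>
  have key: "Y = 0" if XY: "\<beta> X Y = 0" and flat: "\<beta> X X \<bullet> \<beta> Y Y = 0" and pos: "X \<bullet> Y \<ge> 0" for Y
  proof (rule ccontr)
    assume "Y \<noteq> 0"
    define K where "K = (norm Y)\<^sup>2"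
    have K: "K > 0"
      using \<open>Y \<noteq> 0\<close> by (simp add: K_def)
    \<comment> \<open>Chosen so that \<open>t\<^sup>2 * f Y\<close> is at most
      \<open>f X * K\<close>, short of the required \<open>2 * f X * K\<close>; the summand 1 allows
      \<open>f Y = 0\<close>.\<close>
    define t where "t = sqrt (f X * K / (f Y + 1))"
    have fY: "f Y \<ge> 0"
      by (simp add: f_def)
    have t2: "t\<^sup>2 = f X * K / (f Y + 1)"
      using fX fY K by (simp add: t_def)
    have t: "t > 0"
      using fX fY K by (simp add: t_def)
    have fXY: "f (X + t *\<^sub>R Y) = f X + t ^ 4 * f Y"
      using XY flat sym[of Y X]
      by (simp add: f_def \<beta>.add_left \<beta>.add_right \<beta>.scaleR_left \<beta>.scaleR_right inner_simps
          inner_commute power4_eq_xxxx)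
    have "1 + t\<^sup>2 * K \<le> (norm (X + t *\<^sub>R Y))\<^sup>2"
      using X1 t pos unfolding K_def power2_norm_eq_inner
      by (simp add: inner_simps inner_commute norm_eq_1 power2_eq_square)
    then have "(1 + t\<^sup>2 * K)\<^sup>2 \<le> ((norm (X + t *\<^sub>R Y))\<^sup>2)\<^sup>2"
      using K by (intro power_mono) auto
    moreover have "(1 + t\<^sup>2 * K)\<^sup>2 = 1 + 2 * t\<^sup>2 * K + (t\<^sup>2 * K)\<^sup>2"
      by (simp add: power2_sum)
    moreover have "((norm (X + t *\<^sub>R Y))\<^sup>2)\<^sup>2 = norm (X + t *\<^sub>R Y) ^ 4"
      by simp
    ultimately have "1 + 2 * t\<^sup>2 * K \<le> norm (X + t *\<^sub>R Y) ^ 4"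
      using zero_le_power2[of "t\<^sup>2 * K"] by linarith
    then have "f X * (1 + 2 * t\<^sup>2 * K) \<le> f X * norm (X + t *\<^sub>R Y) ^ 4"
      using fX by (intro mult_left_mono) auto
    then have "f X * (1 + 2 * t\<^sup>2 * K) \<le> f X + t ^ 4 * f Y"
      using min[of "X + t *\<^sub>R Y"] fXY by simp
    then have "t\<^sup>2 * (2 * f X * K) \<le> t\<^sup>2 * (t\<^sup>2 * f Y)"
      by (simp add: algebra_simps power4_eq_xxxx power2_eq_square)
    then have "2 * f X * K \<le> t\<^sup>2 * f Y"
      using t by (metis mult_le_cancel_left_pos zero_less_power)
    also have "\<dots> \<le> f X * K"
      unfolding t2 using fX K fY by (simp add: field_simps)
    finally show False
      using fX K by simp
  qed
  have "Y = 0" if "\<beta> X Y = 0" "\<beta> X X \<bullet> \<beta> Y Y = 0" for Y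
    using key[of Y] key[of "- Y"] that linear[of "X \<bullet> Y" 0]
    by (auto simp: \<beta>.minus_left \<beta>.minus_right)
  then show thesis
    using that X0 by blast
qed

lemma linear_into_subspace_kernel:
  fixes L :: "'e::euclidean_space \<Rightarrow> 'f::euclidean_space"
  assumes "linear L" and N: "subspace N" "range L \<subseteq> N" and "dim N < DIM('e)"
  obtains Y where "Y \<noteq> 0" "L Y = 0"
proof -
  have "\<not> inj L"
  proof
    assume "inj L"
    then have "dim (range L) = DIM('e)"
      using dim_image_eq[OF \<open>linear L\<close>, of UNIV] by simp
    then show False
      using dim_subset[OF N(2)] assms(4) by simp
  qed
  then show thesis
    using that linear_injective_0[OF \<open>linear L\<close>] by blast
qed

text \<open>Through the Gauss equation, \<open>flat\<close> says that curvature commutes with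
  \<open>J\<close>; \<open>N\<close> stands for the normal space. If no such vector exists, counting
  dimensions gives for the \<open>X\<close> of \<open>bilinear_anisotropic_pair\<close> some
  \<open>Y \<noteq> 0\<close> with \<open>\<beta> X Y = \<beta> X (J Y) = 0\<close>, and
  \<open>gauss\<close> contradicts the choice of \<open>X\<close>.\<close>

lemma flat_complex_bilinear_zero:
  fixes \<alpha> :: "'e::euclidean_space \<Rightarrow> 'e \<Rightarrow> 'f::euclidean_space"
  assumes bil: "bilinear \<alpha>" and sym: "\<And>X Y. \<alpha> X Y = \<alpha> Y X"
    and J: "linear J" and J2: "\<And>X. J (J X) = - X"
    and flat: "\<And>a b c w. \<alpha> a (J b) \<bullet> \<alpha> c (J w) - \<alpha> c (J b) \<bullet> \<alpha> a (J w)
                 = \<alpha> a b \<bullet> \<alpha> c w - \<alpha> c b \<bullet> \<alpha> a w"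
    and N: "subspace N" "\<And>X Y. \<alpha> X Y \<in> N" "2 * dim N < DIM('e)"
  obtains X where "X \<noteq> 0" "\<alpha> X X + \<alpha> (J X) (J X) = 0"
proof -
  define \<beta> where "\<beta> X Y = \<alpha> X Y + \<alpha> (J X) (J Y)" for X Y
  have lin: "linear (\<alpha> X)" "linear (\<lambda>Y. \<alpha> Y X)" for X
    using bil by (auto simp: bilinear_def)
  note lins = linear_compose[OF J, unfolded o_def] lin linear_compose_add linear_compose_sub
  have bil\<beta>: "bilinear \<beta>"
    unfolding bilinear_def \<beta>_def by (auto intro!: lins)
  have sym\<beta>: "\<beta> X Y = \<beta> Y X" for X Y
    by (simp add: \<beta>_def sym)
  have \<beta>J: "\<beta> X (J Y) = \<alpha> X (J Y) - \<alpha> (J X) Y" for X Y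
    by (simp add: \<beta>_def J2 bilinear_rneg[OF bil])
  have gauss: "\<beta> X X \<bullet> \<beta> Y Y = \<beta> X Y \<bullet> \<beta> X Y + \<beta> X (J Y) \<bullet> \<beta> X (J Y)" for X Y
  proof -
    note neg = J2 bilinear_rneg[OF bil] bilinear_lneg[OF bil] inner_minus_left inner_minus_right
    note [simp] = sym[of Y X] sym[of "J X" X] sym[of "J Y" X] sym[of "J X" Y] sym[of "J Y" Y]
      sym[of "J Y" "J X"]
    \<comment> \<open>In the sum of the four instances the terms
      \<open>\<alpha> X (J X) \<bullet> \<alpha> Y (J Y)\<close> cancel, and the others complete the
      squares of \<open>\<alpha> X Y + \<alpha> (J X) (J Y)\<close> and
      \<open>\<alpha> X (J Y) - \<alpha> (J X) Y\<close>.\<close>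
    note R = flat[of X X Y Y] flat[of X X "J Y" "J Y"] flat[of "J X" "J X" Y Y]
      flat[of "J X" "J X" "J Y" "J Y"]
    show ?thesis
      using R unfolding \<beta>_def neg inner_add_left inner_add_right
      by (simp add: inner_commute)
  qed
  show thesis
  proof (rule ccontr)
    assume "\<not> thesis"
    then have "\<And>X. X \<noteq> 0 \<Longrightarrow> \<beta> X X \<noteq> 0"
      using that by (auto simp: \<beta>_def)
    then obtain X where X: "X \<noteq> 0" "\<And>Y. \<beta> X Y = 0 \<Longrightarrow> \<beta> X X \<bullet> \<beta> Y Y = 0 \<Longrightarrow> Y = 0"
      using bilinear_anisotropic_pair[OF bil\<beta> sym\<beta>] by metis
    define L where "L Y = (\<beta> X Y, \<beta> X (J Y))" for Y
    have "linear (\<beta> X)"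
      using bil\<beta> by (simp add: bilinear_def)
    then have "linear L"
      unfolding L_def by (intro linearI)
        (auto simp: linear_add[OF J] linear_add linear_scale[OF J] linear_scale)
    moreover have "subspace (N \<times> N)"
      using N(1) by (intro subspace_Times)
    moreover have "range L \<subseteq> N \<times> N"
      using N by (auto simp: L_def \<beta>_def intro: subspace_add)
    moreover have "dim (N \<times> N) < DIM('e)"
      using N by (simp add: dim_Times)
    ultimately obtain Y where "Y \<noteq> 0" "L Y = 0"
      by (rule linear_into_subspace_kernel)
    then show False
      using X(2)[of Y] gauss[of X Y] by (auto simp: L_def zero_prod_def)
  qed
qed

section \<open>Immersions of open subsets of Euclidean space\<close>

text \<open>Models the chart expression of the isometric immersion. The metric is the one induced by
  \<open>\<psi>\<close>, so it is always written as \<open>P z a \<bullet> P z b\<close>.\<close>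

locale local_immersion =
  fixes U :: "'e::euclidean_space set" and \<psi> :: "'e \<Rightarrow> 'f::euclidean_space"
  assumes open_U: "open U" and smooth: "smooth_on U \<psi>"
    and immersive: "z \<in> U \<Longrightarrow> frechet_derivative \<psi> (at z) a = 0 \<Longrightarrow> a = 0"
begin

definition P :: "'e \<Rightarrow> 'e \<Rightarrow> 'f" where
  "P z = frechet_derivative \<psi> (at z)"

definition H :: "'e \<Rightarrow> 'e \<Rightarrow> 'e \<Rightarrow> 'f" where
  "H z a b = frechet_derivative (\<lambda>z. P z b) (at z) a"

text \<open>The components of the Levi-Civita connection of the induced metric: \<open>P z (\<Gamma> z a b)\<close> is the
  tangential part of \<open>H z a b\<close>.\<close>

definition \<Gamma> :: "'e \<Rightarrow> 'e \<Rightarrow> 'e \<Rightarrow> 'e" where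
  "\<Gamma> z a b = (THE c. \<forall>w. P z c \<bullet> P z w = H z a b \<bullet> P z w)"

text \<open>The second fundamental form: \<open>\<Gamma>\<close> accounts for the tangential part of
  \<open>H\<close>, so the normal part remains.\<close>

definition sff :: "'e \<Rightarrow> 'e \<Rightarrow> 'e \<Rightarrow> 'f" where
  "sff z a b = H z a b - P z (\<Gamma> z a b)"

section \<open>Tangential and normal parts of the second derivative\<close>

lemma smooth_P: "smooth_on U (\<lambda>z. P z a)"
  unfolding P_def by (intro smooth_on_frechet_derivative open_U smooth)

lemma \<psi>_derivative: "z \<in> U \<Longrightarrow> (\<psi> has_derivative P z) (at z)"
  unfolding P_def by (intro smooth_on_has_derivative[of U] smooth)

lemma P_derivative: "z \<in> U \<Longrightarrow> ((\<lambda>z. P z b) has_derivative (\<lambda>a. H z a b)) (at z)"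
  unfolding H_def by (intro smooth_on_has_derivative[of U] smooth_P)

lemma linear_P: "z \<in> U \<Longrightarrow> linear (P z)"
  using \<psi>_derivative has_derivative_linear by blast

lemma H_sym: "z \<in> U \<Longrightarrow> H z a b = H z b a"
  unfolding H_def P_def by (intro second_derivative_symmetric[of U] open_U smooth)

lemma linear_H_left: "z \<in> U \<Longrightarrow> linear (\<lambda>a. H z a b)"
  using P_derivative has_derivative_linear by blast

lemma linear_H_right: "z \<in> U \<Longrightarrow> linear (H z a)"
  using linear_H_left[of z a] H_sym[of z a] by presburger

lemma P_inner_cancel:
  assumes "z \<in> U" "\<And>w. P z c \<bullet> P z w = P z d \<bullet> P z w"
  shows "c = d"
proof -
  have lin: "P z (c - d) = P z c - P z d"
    using linear_diff[OF linear_P[OF assms(1)]] .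
  have "P z (c - d) \<bullet> P z (c - d) = 0"
    using assms(2)[of "c - d"] by (simp add: lin inner_diff_left)
  then show ?thesis
    using immersive[OF assms(1), of "c - d"] by (simp add: P_def)
qed

lemma \<Gamma>_unique:
  assumes "z \<in> U" "\<And>w. P z c \<bullet> P z w = H z a b \<bullet> P z w"
  shows "\<Gamma> z a b = c"
  unfolding \<Gamma>_def
proof (rule the_equality)
  show "d = c" if "\<forall>w. P z d \<bullet> P z w = H z a b \<bullet> P z w" for d
    using that assms by (intro P_inner_cancel[OF assms(1)]) simp
qed (use assms(2) in blast)

text \<open>Existence behind the description \<open>\<Gamma>\<close>: the orthogonal projection of
  \<open>H z a b\<close> onto the range of \<open>P z\<close> is some \<open>P z c\<close>.\<close>

lemma \<Gamma>_inner:
  assumes "z \<in> U"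
  shows "P z (\<Gamma> z a b) \<bullet> P z w = H z a b \<bullet> P z w"
proof -
  have sub: "subspace (range (P z))"
    using linear_subspace_image[OF linear_P[OF assms] subspace_UNIV] .
  obtain y n where y: "y \<in> span (range (P z))"
    and n: "\<And>w. w \<in> span (range (P z)) \<Longrightarrow> orthogonal n w" and yn: "H z a b = y + n"
    using orthogonal_subspace_decomp_exists[of "range (P z)" "H z a b"] by blast
  then obtain c where c: "y = P z c"
    unfolding span_eq_iff[THEN iffD2, OF sub] by blast
  have "P z c \<bullet> P z w = H z a b \<bullet> P z w" for w
    using n[of "P z w"] by (simp add: yn c inner_add_left orthogonal_def span_base)
  then show ?thesis
    using \<Gamma>_unique[OF assms, of c a b] by simp
qed

lemma sff_normal: "z \<in> U \<Longrightarrow> sff z a b \<bullet> P z w = 0"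
  by (simp add: sff_def inner_diff_left \<Gamma>_inner)

lemma H_decomp: "H z a b = P z (\<Gamma> z a b) + sff z a b"
  by (simp add: sff_def)

lemma sff_sym: "z \<in> U \<Longrightarrow> sff z a b = sff z b a"
  by (simp add: sff_def \<Gamma>_def H_sym[of z a b])

text \<open>Uniqueness of \<open>\<Gamma>\<close> transfers additivity and homogeneity from
  \<open>H\<close>; the second argument follows by symmetry.\<close>

lemma bilinear_sff:
  assumes "z \<in> U"
  shows "bilinear (sff z)"
proof -
  note P = linear_P[OF assms] and HL = linear_H_left[OF assms]
  have "linear (\<lambda>a. sff z a b)" for b
  proof (rule linearI)
    fix a a' and r :: real
    have "\<Gamma> z (a + a') b = \<Gamma> z a b + \<Gamma> z a' b"
      by (rule \<Gamma>_unique[OF assms])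
        (simp add: linear_add[OF P] linear_add[OF HL] inner_add_left \<Gamma>_inner[OF assms])
    then show "sff z (a + a') b = sff z a b + sff z a' b"
      by (simp add: sff_def linear_add[OF P] linear_add[OF HL])
    have "\<Gamma> z (r *\<^sub>R a) b = r *\<^sub>R \<Gamma> z a b"
      by (rule \<Gamma>_unique[OF assms])
        (simp add: linear_scale[OF P] linear_scale[OF HL] \<Gamma>_inner[OF assms])
    then show "sff z (r *\<^sub>R a) b = r *\<^sub>R sff z a b"
      by (simp add: sff_def linear_scale[OF P] linear_scale[OF HL] scaleR_diff_right)
  qed
  moreover from this have "linear (\<lambda>b. sff z a b)" for a
    unfolding sff_sym[OF assms, of a] .
  ultimately show ?thesis
    by (simp add: bilinear_def)
qed

text \<open>By the product rule for \<open>P y a \<bullet> P y b\<close> and the symmetry of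
  \<open>H\<close>, the Koszul expression collapses to \<open>2 * (H y a b \<bullet> P y w)\<close>.
  The function \<open>m\<close> will be the metric of the manifold in a chart.\<close>

lemma THE_koszul_eq_\<Gamma>:
  assumes "y \<in> U" and m: "\<And>z a b. z \<in> U \<Longrightarrow> m z a b = P z a \<bullet> P z b"
  shows "(THE z. \<forall>w. 2 * m y z w = frechet_derivative (\<lambda>y. m y b w) (at y) a
      + frechet_derivative (\<lambda>y. m y a w) (at y) b - frechet_derivative (\<lambda>y. m y a b) (at y) w)
    = \<Gamma> y a b"
proof -
  have "frechet_derivative (\<lambda>y. m y b w) (at y) a = P y b \<bullet> H y a w + H y a b \<bullet> P y w" for a b w
  proof -
    have "((\<lambda>y. P y b \<bullet> P y w) has_derivative (\<lambda>a. P y b \<bullet> H y a w + H y a b \<bullet> P y w)) (at y)"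
      by (intro has_derivative_inner P_derivative assms(1))
    then have "((\<lambda>y. m y b w) has_derivative (\<lambda>a. P y b \<bullet> H y a w + H y a b \<bullet> P y w)) (at y)"
      by (rule has_derivative_transform_within_open[OF _ open_U assms(1)]) (simp add: m)
    then show ?thesis
      by (simp add: frechet_derivative_unique)
  qed
  then show ?thesis
    using H_sym[OF assms(1), of b] H_sym[OF assms(1), of _ a]
    by (simp add: m[OF assms(1)] \<Gamma>_def inner_commute)
qed

section \<open>Functions composed with an immersion\<close>

lemma compose_derivative:
  assumes "z \<in> U" and f: "\<And>y. (f has_derivative (\<lambda>h. G y \<bullet> h)) (at y)"
  shows "((f \<circ> \<psi>) has_derivative (\<lambda>b. G (\<psi> z) \<bullet> P z b)) (at z)"
  unfolding o_def by (rule has_derivative_compose[OF \<psi>_derivative[OF assms(1)] f])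

lemma compose_derivative2:
  fixes G :: "'f \<Rightarrow> 'f"
  assumes "z \<in> U" and G: "\<And>y. (G has_derivative G' y) (at y)"
  shows "((\<lambda>z. G (\<psi> z) \<bullet> P z b) has_derivative
    (\<lambda>a. G (\<psi> z) \<bullet> H z a b + G' (\<psi> z) (P z a) \<bullet> P z b)) (at z)"
  by (intro has_derivative_inner has_derivative_compose[OF \<psi>_derivative G] P_derivative assms(1))

text \<open>The tangential part of \<open>H z a b\<close> cancels against the connection term. What
  remains is the Euclidean Hessian and the gradient \<open>G\<close> paired with the normal
  part.\<close>

lemma hessian_compose:
  fixes f :: "'f \<Rightarrow> real"
  assumes "z \<in> U" and f: "\<And>y. (f has_derivative (\<lambda>h. G y \<bullet> h)) (at y)"
    and G: "\<And>y. (G has_derivative G' y) (at y)"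
  shows "frechet_derivative (\<lambda>z. frechet_derivative (f \<circ> \<psi>) (at z) b) (at z) a
      - frechet_derivative (f \<circ> \<psi>) (at z) (\<Gamma> z a b)
    = G' (\<psi> z) (P z a) \<bullet> P z b + G (\<psi> z) \<bullet> sff z a b"
proof -
  have D: "frechet_derivative (f \<circ> \<psi>) (at z) = (\<lambda>b. G (\<psi> z) \<bullet> P z b)" if "z \<in> U" for z
    using compose_derivative[OF that f] by (rule frechet_derivative_unique)
  have "((\<lambda>z. frechet_derivative (f \<circ> \<psi>) (at z) b) has_derivative
      (\<lambda>a. G (\<psi> z) \<bullet> H z a b + G' (\<psi> z) (P z a) \<bullet> P z b)) (at z)"
    using compose_derivative2[OF assms(1) G]
    by (rule has_derivative_transform_within_open[OF _ open_U assms(1)]) (simp add: D)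
  then show ?thesis
    by (simp add: frechet_derivative_unique D[OF assms(1)] sff_def inner_diff_right)
qed

text \<open>Continuity of \<open>G'\<close> is joint because the base point \<open>\<psi> z\<close>
  and the vector \<open>P z a\<close> both vary with \<open>z\<close>.\<close>

lemma C_2_compose:
  fixes f :: "'f \<Rightarrow> real"
  assumes f: "\<And>y. (f has_derivative (\<lambda>h. G y \<bullet> h)) (at y)"
    and G: "\<And>y. (G has_derivative G' y) (at y)"
    and G': "continuous_on UNIV (\<lambda>(y, h). G' y h)"
  shows "C_k_on 2 U (f \<circ> \<psi>)"
proof -
  have cont: "continuous_on U (\<lambda>z. P z a)" "continuous_on U (\<lambda>z. H z a b)" for a b
    unfolding H_def by (intro smooth_on_continuous_on smooth_on_frechet_derivative smooth_P open_U)+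
  have cont\<psi>: "continuous_on U \<psi>" and contG: "continuous_on U (\<lambda>z. G (\<psi> z))"
    using smooth_on_continuous_on[OF smooth] continuous_on_compose2[of UNIV G U \<psi>] G
    by (auto simp: continuous_on_eq_continuous_at intro: has_derivative_continuous)
  have contG': "continuous_on U (\<lambda>z. G' (\<psi> z) (P z a))" for a
    using continuous_on_compose2[OF G' continuous_on_Pair[OF cont\<psi> cont(1)], of a] by simp
  have "C_k_on (Suc (Suc 0)) U (f \<circ> \<psi>)"
  proof (rule C_k_on_SucI[OF open_U compose_derivative[OF _ f]])
    fix b :: 'e
    show "C_k_on (Suc 0) U (\<lambda>z. G (\<psi> z) \<bullet> P z b)"
    proof (rule C_k_on_SucI[OF open_U compose_derivative2[OF _ G]])
      show "C_k_on 0 U (\<lambda>z. G (\<psi> z) \<bullet> H z a b + G' (\<psi> z) (P z a) \<bullet> P z b)" for a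
        unfolding C_k_on.simps(1) by (intro continuous_intros cont contG contG')
    qed
  qed
  then show ?thesis
    by (simp only: numeral_2_eq_2)
qed

text \<open>The second derivatives of \<open>F\<close> cancel by symmetry. For
  \<open>F = (\<lambda>z. P z b)\<close> this removes the third derivatives of
  \<open>\<psi>\<close>, as in the proof of the Gauss equation.\<close>

lemma antisymmetrized_derivative:
  fixes F W :: "'e \<Rightarrow> 'f"
  assumes "z \<in> U" and F: "smooth_on U F" and W: "smooth_on U W"
  shows "frechet_derivative (\<lambda>z. frechet_derivative F (at z) a \<bullet> W z) (at z) c
       - frechet_derivative (\<lambda>z. frechet_derivative F (at z) c \<bullet> W z) (at z) a
       = frechet_derivative F (at z) a \<bullet> frechet_derivative W (at z) c
       - frechet_derivative F (at z) c \<bullet> frechet_derivative W (at z) a"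
proof -
  have "frechet_derivative (\<lambda>z. frechet_derivative F (at z) a \<bullet> W z) (at z)
    = (\<lambda>h. frechet_derivative F (at z) a \<bullet> frechet_derivative W (at z) h
        + frechet_derivative (\<lambda>z. frechet_derivative F (at z) a) (at z) h \<bullet> W z)" for a
    by (intro frechet_derivative_unique has_derivative_inner smooth_on_has_derivative[of U]
        smooth_on_frechet_derivative open_U F W assms(1))
  then show ?thesis
    using second_derivative_symmetric[OF open_U assms(1) F, of a c] by simp
qed

end

section \<open>Parallel complex structures along an immersion\<close>

locale local_kaehler_immersion = local_immersion U \<psi>
  for U :: "'e::euclidean_space set" and \<psi> :: "'e \<Rightarrow> 'f::euclidean_space" +
  fixes J :: "'e \<Rightarrow> 'e \<Rightarrow> 'e"
  assumes J_smooth: "smooth_on U (\<lambda>z. J z b)"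
    and J_linear: "z \<in> U \<Longrightarrow> linear (J z)"
    and J_square: "z \<in> U \<Longrightarrow> J z (J z b) = - b"
    and J_orthogonal: "z \<in> U \<Longrightarrow> P z (J z a) \<bullet> P z (J z b) = P z a \<bullet> P z b"
    and J_parallel: "z \<in> U \<Longrightarrow>
      frechet_derivative (\<lambda>z. J z b) (at z) a + \<Gamma> z a (J z b) - J z (\<Gamma> z a b) = 0"
begin

definition Q :: "'e \<Rightarrow> 'e \<Rightarrow> 'f" where
  "Q z b = P z (J z b)"

text \<open>Although \<open>J z b\<close> varies with \<open>z\<close>, this writes \<open>Q\<close>
  as a finite sum of products, open to the product rule and to the closure properties of
  \<open>C_k_on\<close>.\<close>

lemma Q_expansion: "z \<in> U \<Longrightarrow> (\<Sum>i\<in>Basis. (J z b \<bullet> i) *\<^sub>R P z i) = Q z b"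
  unfolding Q_def by (intro linear_basis_expansion linear_P)

lemma smooth_Q: "smooth_on U (\<lambda>z. Q z b)"
proof -
  have "C_k_on k U (\<lambda>z. \<Sum>i\<in>Basis. (J z b \<bullet> i) *\<^sub>R P z i)" for k
    using J_smooth smooth_P unfolding smooth_on_def
    by (intro C_k_on_sum bounded_bilinear.C_k_on_bilinear[OF bounded_bilinear_scaleR]
        bounded_bilinear.C_k_on_bilinear[OF bounded_bilinear_inner] C_k_on_const open_U) auto
  then show ?thesis
    unfolding smooth_on_def by (subst C_k_on_cong[OF open_U Q_expansion, symmetric]) auto
qed

text \<open>The product rule gives \<open>H z a (J z b)\<close> plus \<open>P z\<close> of the
  derivative of \<open>J\<close>. Parallelism turns that derivative into
  \<open>J z (\<Gamma> z a b) - \<Gamma> z a (J z b)\<close>, whose second term cancels the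
  tangential part of \<open>H z a (J z b)\<close>.\<close>

lemma Q_derivative:
  assumes "z \<in> U"
  shows "frechet_derivative (\<lambda>z. Q z b) (at z) a = P z (J z (\<Gamma> z a b)) + sff z a (J z b)"
proof -
  let ?DJ = "frechet_derivative (\<lambda>z. J z b) (at z)"
  have "((\<lambda>z. \<Sum>i\<in>Basis. (J z b \<bullet> i) *\<^sub>R P z i) has_derivative
      (\<lambda>a. \<Sum>i\<in>Basis. (J z b \<bullet> i) *\<^sub>R H z a i + (?DJ a \<bullet> i) *\<^sub>R P z i)) (at z)"
    by (intro has_derivative_sum has_derivative_scaleR has_derivative_inner_left P_derivative
        smooth_on_has_derivative[of U] J_smooth assms)
  then have "((\<lambda>z. Q z b) has_derivative
      (\<lambda>a. \<Sum>i\<in>Basis. (J z b \<bullet> i) *\<^sub>R H z a i + (?DJ a \<bullet> i) *\<^sub>R P z i)) (at z)"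
    by (rule has_derivative_transform_within_open[OF _ open_U assms Q_expansion])
  then have "frechet_derivative (\<lambda>z. Q z b) (at z) a
      = (\<Sum>i\<in>Basis. (J z b \<bullet> i) *\<^sub>R H z a i + (?DJ a \<bullet> i) *\<^sub>R P z i)"
    by (simp add: frechet_derivative_unique)
  also have "\<dots> = H z a (J z b) + P z (?DJ a)"
    by (simp add: sum.distrib linear_basis_expansion linear_H_right linear_P assms)
  also have "?DJ a = J z (\<Gamma> z a b) - \<Gamma> z a (J z b)"
    using J_parallel[OF assms, of b a] by (simp add: algebra_simps)
  finally show ?thesis
    by (simp add: H_decomp linear_diff[OF linear_P[OF assms]])
qed

text \<open>Since \<open>J\<close> is parallel and orthogonal, the tangential parts of the derivatives of \<open>P\<close> and
  \<open>Q\<close> have the same inner products.  Differentiating \<open>D\<^sub>a (Q b) \<bullet> Q w = D\<^sub>a (P b) \<bullet> P w\<close> in direction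
  \<open>c\<close> and antisymmetrizing in \<open>a\<close> and \<open>c\<close> is the Gauss equation together with
  \<open>R(a, c) J = J R(a, c)\<close>, without the curvature tensor.\<close>

lemma sff_flat:
  assumes "z \<in> U"
  shows "sff z a (J z b) \<bullet> sff z c (J z w) - sff z c (J z b) \<bullet> sff z a (J z w)
       = sff z a b \<bullet> sff z c w - sff z c b \<bullet> sff z a w"
proof -
  have eq: "frechet_derivative (\<lambda>z. Q z b) (at z) a \<bullet> Q z w
      = frechet_derivative (\<lambda>z. P z b) (at z) a \<bullet> P z w" if "z \<in> U" for z a b w
    using that sff_normal[of z] J_orthogonal[of z]
    by (simp add: Q_derivative inner_add_left \<Gamma>_inner flip: H_def) (simp add: Q_def \<Gamma>_inner)
  have "frechet_derivative (\<lambda>z. frechet_derivative (\<lambda>z. P z b) (at z) a \<bullet> P z w) (at z)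
      = frechet_derivative (\<lambda>z. frechet_derivative (\<lambda>z. Q z b) (at z) a \<bullet> Q z w) (at z)"
    for a b w
  proof (rule frechet_derivative_transform_within_open[OF _ open_U assms])
    show "(\<lambda>z. frechet_derivative (\<lambda>z. P z b) (at z) a \<bullet> P z w) differentiable at z"
      using has_derivative_inner[OF
          smooth_on_has_derivative[OF smooth_on_frechet_derivative[OF open_U smooth_P] assms]
          smooth_on_has_derivative[OF smooth_P assms]]
      by (rule differentiableI)
  qed (simp add: eq)
  \<comment> \<open>By \<open>eq\<close> the same functions are antisymmetrized on both sides, so
    only products of first derivatives of \<open>Q\<close> and \<open>P\<close> are left to
    compare.\<close>
  then have "frechet_derivative (\<lambda>z. Q z b) (at z) a \<bullet> frechet_derivative (\<lambda>z. Q z w) (at z) c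
      - frechet_derivative (\<lambda>z. Q z b) (at z) c \<bullet> frechet_derivative (\<lambda>z. Q z w) (at z) a
      = H z a b \<bullet> H z c w - H z c b \<bullet> H z a w"
    using antisymmetrized_derivative[OF assms smooth_P smooth_P, of b a w c]
      antisymmetrized_derivative[OF assms smooth_Q smooth_Q, of b a w c]
    by (simp add: H_def)
  moreover have "P z w \<bullet> sff z a b = 0" for a b w
    using sff_normal[OF assms] by (simp add: inner_commute)
  \<comment> \<open>Mixed tangential-normal products vanish, and the tangential products agree by
    orthogonality of \<open>J\<close>, leaving those of \<open>sff\<close>.\<close>
  ultimately show ?thesis
    by (simp add: Q_derivative[OF assms] H_decomp inner_add_left inner_add_right
        sff_normal[OF assms] J_orthogonal[OF assms])
qed

text \<open>Here \<open>N\<close> is the normal space, of dimension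
  \<open>DIM('f) - DIM('e)\<close>; the dimension hypothesis says that twice this is below
  \<open>DIM('e)\<close>.\<close>

lemma sff_complex_zero:
  assumes "z \<in> U" "2 * DIM('f) < 3 * DIM('e)"
  obtains X where "X \<noteq> 0" "sff z X X + sff z (J z X) (J z X) = 0"
proof -
  define N where "N = {y. \<forall>w. P z w \<bullet> y = 0}"
  have sub: "subspace (range (P z))"
    using linear_subspace_image[OF linear_P[OF assms(1)] subspace_UNIV] .
  have "inj (P z)"
    using linear_injective_0[OF linear_P[OF assms(1)]] immersive[OF assms(1)] by (simp add: P_def)
  then have "dim (range (P z)) = DIM('e)"
    using dim_image_eq[OF linear_P[OF assms(1)], of UNIV] by simp
  moreover have "dim {y \<in> UNIV. \<forall>x \<in> range (P z). orthogonal x y} + dim (range (P z)) = dim (UNIV :: 'f set)"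
    by (intro dim_subspace_orthogonal_to_vectors sub) auto
  ultimately have "dim N + DIM('e) = DIM('f)"
    by (simp add: N_def orthogonal_def)
  moreover have "subspace N"
    by (auto simp: N_def subspace_def inner_add_right)
  moreover have "sff z X Y \<in> N" for X Y
    using sff_normal[OF assms(1)] by (simp add: N_def inner_commute)
  moreover have "2 * dim N < DIM('e)"
    using \<open>dim N + DIM('e) = DIM('f)\<close> assms(2) by linarith
  ultimately show thesis
    using flat_complex_bilinear_zero[OF bilinear_sff[OF assms(1)] sff_sym[OF assms(1)]
        J_linear[OF assms(1)] J_square[OF assms(1)] sff_flat[OF assms(1)], of N] that
    by blast
qed

text \<open>Since \<open>sff z X X + sff z (J z X) (J z X) = 0\<close>, the gradient pairs nonnegatively with one of the
  two summands.\<close>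

lemma hessian_lower_direction:
  assumes "z \<in> U" "2 * DIM('f) < 3 * DIM('e)"
    and "\<And>y. (f has_derivative (\<lambda>h. G y \<bullet> h)) (at y)" "\<And>y. (G has_derivative G' y) (at y)"
  obtains X where "norm (P z X) = 1"
    "G' (\<psi> z) (P z X) \<bullet> P z X
      \<le> frechet_derivative (\<lambda>z. frechet_derivative (f \<circ> \<psi>) (at z) X) (at z) X
        - frechet_derivative (f \<circ> \<psi>) (at z) (\<Gamma> z X X)"
proof -
  obtain X where X: "X \<noteq> 0" "sff z X X + sff z (J z X) (J z X) = 0"
    using sff_complex_zero[OF assms(1,2)] by blast
  have "J z X \<noteq> 0"
  proof
    assume "J z X = 0"
    then have "J z (J z X) = 0"
      using linear_0[OF J_linear[OF assms(1)]] by simp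
    then show False
      using J_square[OF assms(1)] X(1) by simp
  qed
  moreover have "G (\<psi> z) \<bullet> sff z X X + G (\<psi> z) \<bullet> sff z (J z X) (J z X) = 0"
    using X(2) by (metis inner_add_right inner_zero_right)
  then have "G (\<psi> z) \<bullet> sff z X X \<ge> 0 \<or> G (\<psi> z) \<bullet> sff z (J z X) (J z X) \<ge> 0"
    by linarith
  ultimately obtain Y where "Y \<noteq> 0" "G (\<psi> z) \<bullet> sff z Y Y \<ge> 0"
    using X(1) by blast
  \<comment> \<open>Rescaling to unit length in the induced metric multiplies the pairing with
    \<open>sff\<close> by a positive square and keeps its sign.\<close>
  define X' where "X' = (1 / norm (P z Y)) *\<^sub>R Y"
  have "P z Y \<noteq> 0"
    using immersive[OF assms(1)] \<open>Y \<noteq> 0\<close> by (auto simp: P_def)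
  then have "norm (P z X') = 1"
    by (simp add: X'_def linear_scale[OF linear_P[OF assms(1)]])
  moreover have "G (\<psi> z) \<bullet> sff z X' X' \<ge> 0"
    using \<open>G (\<psi> z) \<bullet> sff z Y Y \<ge> 0\<close>
    by (simp add: X'_def bilinear_lmul[OF bilinear_sff[OF assms(1)]]
        bilinear_rmul[OF bilinear_sff[OF assms(1)]])
  ultimately show thesis
    by (intro that[of X']) (simp_all add: hessian_compose[OF assms(1,3,4)])
qed

end

section \<open>A function bounded above on a cone\<close>

text \<open>A smoothing, by \<open>T\<close>, of \<open>\<kappa> * norm y - y \<bullet> v\<close>,
  which is at most 0 on the cone when \<open>\<kappa>\<close> is the cosine of its width. The next
  two definitions are its gradient and the derivative of that gradient.\<close>

definition barrier :: "real \<Rightarrow> real \<Rightarrow> 'f::euclidean_space \<Rightarrow> 'f \<Rightarrow> real" where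
  "barrier T \<kappa> v y = sqrt (T\<^sup>2 + \<kappa>\<^sup>2 * (y \<bullet> y)) - y \<bullet> v"

definition barrier_grad :: "real \<Rightarrow> real \<Rightarrow> 'f::euclidean_space \<Rightarrow> 'f \<Rightarrow> 'f" where
  "barrier_grad T \<kappa> v y = (\<kappa>\<^sup>2 / sqrt (T\<^sup>2 + \<kappa>\<^sup>2 * (y \<bullet> y))) *\<^sub>R y - v"

definition barrier_hess :: "real \<Rightarrow> real \<Rightarrow> 'f::euclidean_space \<Rightarrow> 'f \<Rightarrow> 'f" where
  "barrier_hess T \<kappa> y h = (\<kappa>\<^sup>2 / sqrt (T\<^sup>2 + \<kappa>\<^sup>2 * (y \<bullet> y))) *\<^sub>R h
     - (\<kappa> ^ 4 * (y \<bullet> h) / sqrt (T\<^sup>2 + \<kappa>\<^sup>2 * (y \<bullet> y)) ^ 3) *\<^sub>R y"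

context
  fixes T \<kappa> :: real and v :: "'f::euclidean_space"
  assumes T: "T > 0"
begin

lemma barrier_radicand_pos: "T\<^sup>2 + \<kappa>\<^sup>2 * (y \<bullet> y) > 0" for y :: 'f
  using T by (intro add_pos_nonneg) auto

lemma sqrt_radicand_derivative:
  "((\<lambda>y. sqrt (T\<^sup>2 + \<kappa>\<^sup>2 * (y \<bullet> y))) has_derivative
    (\<lambda>h. \<kappa>\<^sup>2 * (y \<bullet> h) / sqrt (T\<^sup>2 + \<kappa>\<^sup>2 * (y \<bullet> y)))) (at y)" for y :: 'f
  using barrier_radicand_pos[of y]
  by (auto intro!: derivative_eq_intros simp: field_simps inner_commute)

lemma barrier_derivative:
  "(barrier T \<kappa> v has_derivative (\<lambda>h. barrier_grad T \<kappa> v y \<bullet> h)) (at y)"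
proof -
  have "((\<lambda>y. sqrt (T\<^sup>2 + \<kappa>\<^sup>2 * (y \<bullet> y)) - y \<bullet> v) has_derivative
      (\<lambda>h. \<kappa>\<^sup>2 * (y \<bullet> h) / sqrt (T\<^sup>2 + \<kappa>\<^sup>2 * (y \<bullet> y)) - h \<bullet> v)) (at y)"
    by (intro has_derivative_diff sqrt_radicand_derivative has_derivative_inner_left has_derivative_ident)
  then show ?thesis
    by (simp add: barrier_def[abs_def] barrier_grad_def inner_diff_left inner_commute[of v])
qed

lemma barrier_grad_derivative:
  "(barrier_grad T \<kappa> v has_derivative barrier_hess T \<kappa> y) (at y)"
proof -
  let ?s = "\<lambda>y::'f. sqrt (T\<^sup>2 + \<kappa>\<^sup>2 * (y \<bullet> y))"
  have s: "?s y \<noteq> 0"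
    using barrier_radicand_pos[of y] by simp
  have "((\<lambda>y. \<kappa>\<^sup>2 / ?s y) has_derivative
      (\<lambda>h. (0 * ?s y - \<kappa>\<^sup>2 * (\<kappa>\<^sup>2 * (y \<bullet> h) / ?s y)) / (?s y * ?s y))) (at y)"
    by (rule has_derivative_divide') (intro has_derivative_const sqrt_radicand_derivative s)+
  then have "((\<lambda>y. \<kappa>\<^sup>2 / ?s y) has_derivative (\<lambda>h. - (\<kappa> ^ 4 * (y \<bullet> h) / ?s y ^ 3))) (at y)"
    by (rule has_derivative_eq_rhs) (simp add: fun_eq_iff power3_eq_cube power2_eq_square power4_eq_xxxx ac_simps)
  then have "((\<lambda>y. (\<kappa>\<^sup>2 / ?s y) *\<^sub>R y - v) has_derivative
      (\<lambda>h. (\<kappa>\<^sup>2 / ?s y) *\<^sub>R h + (- (\<kappa> ^ 4 * (y \<bullet> h) / ?s y ^ 3)) *\<^sub>R y - 0)) (at y)"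
    by (intro has_derivative_diff has_derivative_scaleR has_derivative_ident has_derivative_const)
  then show ?thesis
    unfolding barrier_grad_def[abs_def] barrier_hess_def[abs_def] by simp
qed

lemma barrier_hess_continuous: "continuous_on UNIV (\<lambda>(y, h). barrier_hess T \<kappa> y (h :: 'f))"
proof -
  have "sqrt (T\<^sup>2 + \<kappa>\<^sup>2 * (fst p \<bullet> fst p)) \<noteq> 0" for p :: "'f \<times> 'f"
    using barrier_radicand_pos[of "fst p"] by simp
  then show ?thesis
    unfolding barrier_hess_def case_prod_unfold by (intro continuous_intros) auto
qed

text \<open>Cauchy-Schwarz controls the rank-one term. For \<open>\<kappa> \<noteq> 0\<close> the
  coefficient of \<open>h \<bullet> h\<close> stays away from 0 as long as \<open>y\<close> is
  bounded.\<close>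

lemma barrier_hess_lower:
  "\<kappa>\<^sup>2 * T\<^sup>2 / sqrt (T\<^sup>2 + \<kappa>\<^sup>2 * (y \<bullet> y)) ^ 3 * (h \<bullet> h) \<le> barrier_hess T \<kappa> y h \<bullet> h" for y h :: 'f
proof -
  define s where "s = sqrt (T\<^sup>2 + \<kappa>\<^sup>2 * (y \<bullet> y))"
  have s: "s > 0" and s2: "s\<^sup>2 = T\<^sup>2 + \<kappa>\<^sup>2 * (y \<bullet> y)"
    using barrier_radicand_pos[of y] by (simp_all add: s_def)
  have "\<kappa>\<^sup>2 * T\<^sup>2 * (h \<bullet> h) = \<kappa>\<^sup>2 * s\<^sup>2 * (h \<bullet> h) - \<kappa> ^ 4 * ((y \<bullet> y) * (h \<bullet> h))"
    unfolding s2 by (simp add: algebra_simps power2_eq_square power4_eq_xxxx)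
  also have "\<dots> \<le> \<kappa>\<^sup>2 * s\<^sup>2 * (h \<bullet> h) - \<kappa> ^ 4 * (y \<bullet> h)\<^sup>2"
    using Cauchy_Schwarz_ineq[of y h] by (intro diff_left_mono mult_left_mono) auto
  finally have "\<kappa>\<^sup>2 * T\<^sup>2 * (h \<bullet> h) / s ^ 3 \<le> (\<kappa>\<^sup>2 * s\<^sup>2 * (h \<bullet> h) - \<kappa> ^ 4 * (y \<bullet> h)\<^sup>2) / s ^ 3"
    using s by (intro divide_right_mono) auto
  also have "\<dots> = barrier_hess T \<kappa> y h \<bullet> h"
    using s unfolding barrier_hess_def s_def[symmetric]
    by (simp add: inner_diff_left field_simps power2_eq_square power3_eq_cube)
  finally show ?thesis
    by (simp add: s_def)
qed

text \<open>With \<open>q = \<kappa> * norm y\<close> the bound comes from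
  \<open>(s - q) * (s + q) = T\<^sup>2\<close>. Keeping the factor \<open>s\<close> lets a positive
  lower bound for the barrier bound \<open>s\<close> from above.\<close>

lemma barrier_upper:
  fixes y :: 'f
  assumes "\<kappa> \<ge> 0" "\<kappa> * norm y \<le> y \<bullet> v"
  shows "barrier T \<kappa> v y * sqrt (T\<^sup>2 + \<kappa>\<^sup>2 * (y \<bullet> y)) \<le> T\<^sup>2"
proof -
  define s where "s = sqrt (T\<^sup>2 + \<kappa>\<^sup>2 * (y \<bullet> y))"
  define q where "q = \<kappa> * norm y"
  have s: "s > 0" and s2: "s\<^sup>2 = T\<^sup>2 + q\<^sup>2"
    using barrier_radicand_pos[of y] by (simp_all add: s_def q_def power_mult_distrib power2_norm_eq_inner)
  have q: "q \<ge> 0"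
    using assms(1) by (simp add: q_def)
  have "q\<^sup>2 \<le> s\<^sup>2"
    unfolding s2 by simp
  then have "q \<le> s"
    by (rule power2_le_imp_le) (use s in simp)
  have "barrier T \<kappa> v y * s \<le> (s - q) * s"
    using assms(2) s by (intro mult_right_mono) (auto simp: barrier_def s_def q_def)
  also have "\<dots> \<le> (s - q) * (s + q)"
    using q \<open>q \<le> s\<close> by (intro mult_left_mono) auto
  also have "\<dots> = T\<^sup>2"
    using s2 by (simp add: algebra_simps power2_eq_square)
  finally show ?thesis
    by (simp add: s_def)
qed

lemma barrier_lower: "norm v = 1 \<Longrightarrow> T - norm y \<le> barrier T \<kappa> v y"
proof -
  assume "norm v = 1"
  then have "y \<bullet> v \<le> norm y"
    using norm_cauchy_schwarz[of y v] by simp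
  moreover have "T \<le> sqrt (T\<^sup>2 + \<kappa>\<^sup>2 * (y \<bullet> y))"
    by (intro real_le_rsqrt) simp
  ultimately show ?thesis
    by (simp add: barrier_def)
qed

end

section \<open>Charts\<close>

context smooth_manifold
begin

lemma chart_inj: "c \<in> A \<Longrightarrow> inj_on (chart_map c) (chart_dom c)"
  using homeomorphic_imp_injective_map[OF homeomorphic_chart] openin_subset[OF open_chart_dom]
  by (simp add: inf.absorb2)

lemma chart_inv_chart_map: "c \<in> A \<Longrightarrow> x \<in> chart_dom c \<Longrightarrow> chart_inv c (chart_map c x) = x"
  unfolding chart_inv_def by (simp add: chart_inj)

lemma chart_map_chart_inv: "y \<in> chart_image c \<Longrightarrow> chart_map c (chart_inv c y) = y"
  unfolding chart_inv_def chart_image_def by (rule f_inv_into_f)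

lemma chart_inv_dom: "y \<in> chart_image c \<Longrightarrow> chart_inv c y \<in> chart_dom c"
  unfolding chart_inv_def chart_image_def by (rule inv_into_into)

lemma chart_dom_subset: "c \<in> A \<Longrightarrow> chart_dom c \<subseteq> topspace M"
  using openin_subset[OF open_chart_dom] .

lemma chart_map_in_image: "x \<in> chart_dom c \<Longrightarrow> chart_map c x \<in> chart_image c"
  by (simp add: chart_image_def)

lemma chart_at:
  assumes "x \<in> topspace M"
  shows "chart_at A x \<in> A" "x \<in> chart_dom (chart_at A x)"
proof -
  have "\<exists>c. c \<in> A \<and> x \<in> chart_dom c"
    using assms covering by blast
  then have "chart_at A x \<in> A \<and> x \<in> chart_dom (chart_at A x)"
    unfolding chart_at_def by (rule someI_ex)
  then show "chart_at A x \<in> A" "x \<in> chart_dom (chart_at A x)"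
    by auto
qed

lemma open_overlap:
  assumes "c \<in> A" "d \<in> A"
  shows "open (chart_map c ` (chart_dom c \<inter> chart_dom d))"
proof -
  have "openin (subtopology M (chart_dom c)) (chart_dom c \<inter> chart_dom d)"
    using open_chart_dom[OF assms(2)] by (metis inf_commute openin_subtopology)
  then have "openin (top_of_set (chart_image c)) (chart_map c ` (chart_dom c \<inter> chart_dom d))"
    using homeomorphic_imp_open_map[OF homeomorphic_chart[OF assms(1)]] unfolding open_map_def by blast
  then show ?thesis
    using open_chart_image[OF assms(1)] openin_open_eq by blast
qed

lemma transition_derivative:
  assumes "c \<in> A" "d \<in> A" "x \<in> chart_dom c" "x \<in> chart_dom d"
  shows "(transition c d has_derivative frechet_derivative (transition c d) (at (chart_map c x)))
    (at (chart_map c x))"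
  using smooth_transition[OF assms(1,2)] assms by (intro smooth_on_has_derivative) auto

lemma transition_chart_map:
  "c \<in> A \<Longrightarrow> x \<in> chart_dom c \<Longrightarrow> transition c d (chart_map c x) = chart_map d x"
  by (simp add: transition_def chart_inv_chart_map)

section \<open>Change of charts and tangent vectors\<close>

lemma chart_change_derivative:
  assumes cd: "c \<in> A" "d \<in> A" "x \<in> chart_dom c" "x \<in> chart_dom d"
    and f: "((f \<circ> chart_inv d) has_derivative f') (at (chart_map d x))"
  shows "((f \<circ> chart_inv c) has_derivative
      (\<lambda>a. f' (frechet_derivative (transition c d) (at (chart_map c x)) a))) (at (chart_map c x))"
proof -
  have "((\<lambda>y. (f \<circ> chart_inv d) (transition c d y)) has_derivative
      (\<lambda>a. f' (frechet_derivative (transition c d) (at (chart_map c x)) a))) (at (chart_map c x))"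
    by (rule has_derivative_compose[OF transition_derivative[OF cd]])
      (simp add: transition_chart_map cd f[unfolded o_def] o_def)
  then show ?thesis
    by (rule has_derivative_transform_within_open[OF _ open_overlap[OF cd(1,2)]])
      (use cd in \<open>auto simp: transition_chart_map chart_inv_chart_map\<close>)
qed

text \<open>\<open>transition c c\<close> is the identity only on the chart image, but that set is
  open, so its derivative there is the identity.\<close>

lemma coord_vector_self:
  assumes "c \<in> A" "x \<in> chart_dom c"
  shows "coord_vector A c x a c = a"
proof -
  have "(transition c c has_derivative (\<lambda>a. a)) (at (chart_map c x))"
    by (rule has_derivative_transform_within_open[OF has_derivative_ident open_chart_image[OF assms(1)]])
      (use assms in \<open>auto simp: transition_def chart_image_def chart_inv_chart_map\<close>)
  then show ?thesis
    using assms by (simp add: coord_vector_def frechet_derivative_unique)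
qed

lemma coord_vector_tangent:
  assumes "c \<in> A" "x \<in> chart_dom c"
  shows "coord_vector A c x a \<in> tangent_space A x"
proof -
  \<comment> \<open>The cocycle rule for derivatives of transition maps: a change of chart applied
    to the coordinate map of \<open>e\<close>.\<close>
  have chain: "frechet_derivative (transition c e) (at (chart_map c x)) a
      = frechet_derivative (transition d e) (at (chart_map d x))
          (frechet_derivative (transition c d) (at (chart_map c x)) a)"
    if "d \<in> A" "x \<in> chart_dom d" "e \<in> A" "x \<in> chart_dom e" for d e
    using frechet_derivative_unique[OF chart_change_derivative[OF assms(1) that(1) assms(2) that(2),
          of "chart_map e", folded transition_def, OF transition_derivative[OF that(1,3,2,4)]]]
    by simp
  show ?thesis
    unfolding tangent_space_def
  proof (intro CollectI conjI ballI allI impI)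
    fix d e assume "d \<in> A" "e \<in> A" "x \<in> chart_dom d \<and> x \<in> chart_dom e"
    then show "coord_vector A c x a e
        = frechet_derivative (transition d e) (at (chart_map d x)) (coord_vector A c x a d)"
      using chain[of d e] by (simp only: coord_vector_def simp_thms if_True)
  qed (simp only: coord_vector_def simp_thms if_False)
qed

text \<open>The transformation law fixes the components in every chart around \<open>x\<close>, and
  the normalisation 0 fixes the rest.\<close>

lemma tangent_eq_coord_vector:
  assumes "v \<in> tangent_space A x" "c \<in> A" "x \<in> chart_dom c"
  shows "v = coord_vector A c x (v c)"
proof
  fix d
  show "v d = coord_vector A c x (v c) d"
  proof (cases "d \<in> A \<and> x \<in> chart_dom d")
    case True
    then have "v d = frechet_derivative (transition c d) (at (chart_map c x)) (v c)"
      using assms unfolding tangent_space_def by blast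
    then show ?thesis
      using True by (simp only: coord_vector_def simp_thms if_True)
  next
    case False
    then have "v d = 0"
      using assms unfolding tangent_space_def by blast
    then show ?thesis
      using False by (simp only: coord_vector_def simp_thms if_False)
  qed
qed

lemma coord_vector_linear:
  assumes "c \<in> A" "x \<in> chart_dom c"
  shows "coord_vector A c x (r *\<^sub>R a + s *\<^sub>R b)
    = (\<lambda>d. r *\<^sub>R coord_vector A c x a d + s *\<^sub>R coord_vector A c x b d)"
proof
  fix d
  show "coord_vector A c x (r *\<^sub>R a + s *\<^sub>R b) d
    = r *\<^sub>R coord_vector A c x a d + s *\<^sub>R coord_vector A c x b d"
  proof (cases "d \<in> A \<and> x \<in> chart_dom d")
    case True
    then have "linear (frechet_derivative (transition c d) (at (chart_map c x)))"
      using transition_derivative[OF assms(1) _ assms(2)] has_derivative_linear by blast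
    then show ?thesis
      using True by (simp add: coord_vector_def linear_add linear_scale)
  qed (auto simp: coord_vector_def)
qed

text \<open>The chain rule makes the value independent of the chart picked by
  \<open>chart_at\<close>.\<close>

lemma differential_coord_vector:
  assumes "smooth_map A \<phi>" "c \<in> A" "x \<in> chart_dom c"
  shows "differential A \<phi> x (coord_vector A c x a)
    = frechet_derivative (\<phi> \<circ> chart_inv c) (at (chart_map c x)) a"
proof -
  let ?d = "chart_at A x"
  have d: "?d \<in> A" "x \<in> chart_dom ?d"
    using chart_at chart_dom_subset assms by blast+
  have "smooth_on (chart_image ?d) (\<phi> \<circ> chart_inv ?d)"
    using assms(1) d(1) by (auto simp: smooth_map_def C_k_map_def smooth_on_def)
  from frechet_derivative_unique[OF chart_change_derivative[OF assms(2) d(1) assms(3) d(2)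
        smooth_on_has_derivative[OF this chart_map_in_image[OF d(2)]]]]
  show ?thesis
    using d by (simp add: differential_def coord_vector_def Let_def)
qed

end

section \<open>An isometrically immersed Kaehler manifold in one chart\<close>

context kaehler_manifold
begin

context
  fixes \<phi> :: "'a \<Rightarrow> 'f::euclidean_space" and c
  assumes iso: "isometric_immersion M A g \<phi>" and c: "c \<in> A"
begin

lemma chart_smooth: "smooth_map A \<phi>" "smooth_on (chart_image c) (\<phi> \<circ> chart_inv c)"
  using iso c by (auto simp: isometric_immersion_def immersion_def smooth_map_def C_k_map_def smooth_on_def)

lemma chart_derivative_inner:
  assumes "x \<in> chart_dom c"
  shows "frechet_derivative (\<phi> \<circ> chart_inv c) (at (chart_map c x)) a
      \<bullet> frechet_derivative (\<phi> \<circ> chart_inv c) (at (chart_map c x)) b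
    = g x (coord_vector A c x a) (coord_vector A c x b)"
  using iso chart_dom_subset[OF c] assms coord_vector_tangent[OF c assms]
  by (auto simp: isometric_immersion_def differential_coord_vector[OF chart_smooth(1) c assms, symmetric])

text \<open>Injectivity of the derivative comes from positivity of \<open>g\<close>: a coordinate
  vector with nonzero components is not the zero vector.\<close>

lemma local_immersion_chart: "local_immersion (chart_image c) (\<phi> \<circ> chart_inv c)"
proof
  show "open (chart_image c)" "smooth_on (chart_image c) (\<phi> \<circ> chart_inv c)"
    using open_chart_image[OF c] chart_smooth by auto
  show "a = 0" if z: "z \<in> chart_image c" "frechet_derivative (\<phi> \<circ> chart_inv c) (at z) a = 0" for z a
  proof (rule ccontr)
    assume "a \<noteq> 0"
    let ?x = "chart_inv c z"
    have x: "?x \<in> chart_dom c"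
      using chart_inv_dom[OF z(1)] .
    then have "coord_vector A c ?x a \<noteq> (\<lambda>_. 0)"
      using coord_vector_self[OF c x, of a] \<open>a \<noteq> 0\<close> by auto
    then have "g ?x (coord_vector A c ?x a) (coord_vector A c ?x a) > 0"
      using metric_pos coord_vector_tangent[OF c x] chart_dom_subset[OF c] x by blast
    then show False
      using chart_derivative_inner[OF x, of a a] z by (simp add: chart_map_chart_inv)
  qed
qed

interpretation local_immersion "chart_image c" "\<phi> \<circ> chart_inv c"
  by (rule local_immersion_chart)

lemma metric_coord_eq:
  assumes "z \<in> chart_image c"
  shows "metric_coord A g c z a b = P z a \<bullet> P z b"
proof -
  have "metric_coord A g c z a b
      = g (chart_inv c z) (coord_vector A c (chart_inv c z) a) (coord_vector A c (chart_inv c z) b)"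
    unfolding metric_coord_def Let_def ..
  moreover have "P z = frechet_derivative (\<phi> \<circ> chart_inv c) (at z)"
    by (rule P_def)
  ultimately show ?thesis
    using chart_derivative_inner[OF chart_inv_dom[OF assms], of a b] chart_map_chart_inv[OF assms]
    by metis
qed

lemma christoffel_eq:
  assumes "z \<in> chart_image c"
  shows "christoffel A g c z a b = \<Gamma> z a b"
  unfolding christoffel_def
  by (rule THE_koszul_eq_\<Gamma>[where m = "metric_coord A g c" and y = z and a = a and b = b,
        OF assms metric_coord_eq])

lemma coord_vector_endo_coord:
  assumes "z \<in> chart_image c"
  shows "coord_vector A c (chart_inv c z) (endo_coord A J c z a)
    = J (chart_inv c z) (coord_vector A c (chart_inv c z) a)"
proof -
  have "chart_inv c z \<in> chart_dom c" "chart_inv c z \<in> topspace M"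
    using chart_inv_dom[OF assms] chart_dom_subset[OF c] by auto
  from tangent_eq_coord_vector[OF J_tangent[OF this(2) coord_vector_tangent[OF c this(1)]] c this(1)]
  show ?thesis
    by (simp add: endo_coord_def Let_def)
qed

text \<open>Each axiom is a manifold axiom read in the components of \<open>c\<close>, once the
  metric and the Christoffel symbols are identified with those induced by the immersion.\<close>

lemma local_kaehler_immersion_chart:
  "local_kaehler_immersion (chart_image c) (\<phi> \<circ> chart_inv c) (endo_coord A J c)"
proof (rule local_kaehler_immersion.intro[OF local_immersion_chart], rule local_kaehler_immersion_axioms.intro)
  show "smooth_on (chart_image c) (\<lambda>z. endo_coord A J c z b)" for b
    using J_smooth[OF c] .
  fix z assume z: "z \<in> chart_image c"
  let ?x = "chart_inv c z"
  have x: "?x \<in> chart_dom c" "?x \<in> topspace M"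
    using chart_inv_dom[OF z] chart_dom_subset[OF c] by auto
  note tan = coord_vector_tangent[OF c x(1)]
  show "endo_coord A J c z (endo_coord A J c z b) = - b" for b
  proof -
    have "endo_coord A J c z (endo_coord A J c z b) = J ?x (J ?x (coord_vector A c ?x b)) c"
      by (simp add: endo_coord_def[of A J c z "endo_coord A J c z b"] Let_def coord_vector_endo_coord[OF z])
    then show ?thesis
      using J_square[OF x(2) tan] by (simp add: coord_vector_self[OF c x(1)])
  qed
  have lin: "endo_coord A J c z (r *\<^sub>R a + s *\<^sub>R b) = r *\<^sub>R endo_coord A J c z a + s *\<^sub>R endo_coord A J c z b"
    for r s a b
    unfolding endo_coord_def Let_def coord_vector_linear[OF c x(1)]
      J_linear[OF x(2) tan[of a] tan[of b], of r s] ..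
  show "linear (endo_coord A J c z)"
  proof (rule linearI)
    show "endo_coord A J c z (a + b) = endo_coord A J c z a + endo_coord A J c z b" for a b
      using lin[of 1 a 1 b] by simp
    show "endo_coord A J c z (r *\<^sub>R a) = r *\<^sub>R endo_coord A J c z a" for r a
      using lin[of r a 0 0] by simp
  qed
  show "P z (endo_coord A J c z a) \<bullet> P z (endo_coord A J c z b) = P z a \<bullet> P z b" for a b
    using J_orthogonal[OF x(2) tan tan]
    by (simp add: metric_coord_eq[OF z, symmetric] metric_coord_def Let_def coord_vector_endo_coord[OF z])
  show "frechet_derivative (\<lambda>z. endo_coord A J c z b) (at z) a + \<Gamma> z a (endo_coord A J c z b)
      - endo_coord A J c z (\<Gamma> z a b) = 0" for a b
    using J_parallel[OF c z] by (simp add: nabla_endo_coord_def christoffel_eq[OF z])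
qed

end

end

section \<open>The barrier along the sequence of the weak maximum principle\<close>

lemma cone_inner_ge:
  assumes "z \<in> cone p v \<theta>"
  shows "cos \<theta> * norm (z - p) \<le> (z - p) \<bullet> v"
proof -
  have "0 < norm (z - p)"
    using assms by (simp add: cone_def)
  moreover have "cos \<theta> \<le> ((z - p) \<bullet> v) / norm (z - p)"
    using assms unfolding cone_def mem_Collect_eq inner_scaleR_left divide_inverse
    by (simp only: mult.commute)
  ultimately show ?thesis
    by (simp add: pos_le_divide_eq)
qed

theorem corollary1p20:
  fixes M :: "'a topology"
    and A :: "('a, real ^ 'n) chart set"
    and g :: "('a, real ^ 'n) metric"
    and J :: "('a, real ^ 'n) endomorphism_field"
    and m :: nat
  assumes "kaehler_manifold M A g J"
    and "connected_space M"
    and "CARD('n) = 2 * m"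
    and "CARD('d) = 3 * m - 1"
    and "weak_maximum_principle_hessian M A g"
  shows "\<not> (\<exists>(\<phi> :: 'a \<Rightarrow> real ^ 'd) C.
              isometric_immersion M A g \<phi> \<and> nondegenerate_cone C \<and> \<phi> ` topspace M \<subseteq> C)"
proof
  assume "\<exists>(\<phi> :: 'a \<Rightarrow> real ^ 'd) C.
      isometric_immersion M A g \<phi> \<and> nondegenerate_cone C \<and> \<phi> ` topspace M \<subseteq> C"
  then obtain \<phi> :: "'a \<Rightarrow> real ^ 'd" and p v \<theta>
    where iso: "isometric_immersion M A g \<phi>" and v: "norm v = 1" and \<theta>: "0 < \<theta>" "\<theta> < pi / 2"
      and cone: "\<phi> ` topspace M \<subseteq> cone p v \<theta>"
    unfolding nondegenerate_cone_def by blast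
  interpret kaehler_manifold M A g J
    by (rule assms(1))
  note wmp = assms(5)[unfolded weak_maximum_principle_hessian_def, rule_format]
  define \<kappa> where "\<kappa> = cos \<theta>"
  have \<kappa>: "\<kappa> > 0"
    using \<theta> by (simp add: \<kappa>_def cos_gt_zero)
  have in_cone: "\<kappa> * norm (\<phi> x - p) \<le> (\<phi> x - p) \<bullet> v" if "x \<in> topspace M" for x
    unfolding \<kappa>_def using cone that by (intro cone_inner_ge) auto
  \<comment> \<open>Nonemptiness of \<open>M\<close> is obtained from the weak maximum principle
    itself, applied to a constant function.\<close>
  have "C_k_map 2 A (\<lambda>_. 0 :: real) \<and> bdd_above ((\<lambda>_. 0 :: real) ` topspace M)"
    by (auto simp: C_k_map_def o_def intro: C_k_on_const)
  then obtain x0 where x0: "x0 \<in> topspace M"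
    using wmp by blast
  \<comment> \<open>One more than the distance of \<open>\<phi> x0\<close> from the vertex, so that
    \<open>barrier_lower\<close> gives \<open>u x0 \<ge> 1\<close>.\<close>
  define T where "T = norm (\<phi> x0 - p) + 1"
  have T: "T > 0"
    by (simp add: T_def add_nonneg_pos)
  define f where "f y = barrier T \<kappa> v (y - p)" for y
  define G where "G y = barrier_grad T \<kappa> v (y - p)" for y
  define G' where "G' y = barrier_hess T \<kappa> (y - p)" for y
  define s where "s x = sqrt (T\<^sup>2 + \<kappa>\<^sup>2 * ((\<phi> x - p) \<bullet> (\<phi> x - p)))" for x
  define u where "u x = f (\<phi> x)" for x
  have shift: "((\<lambda>y. y - p) has_derivative (\<lambda>h. h)) (at y)" for y
    by (auto intro!: derivative_eq_intros)
  have fG: "(f has_derivative (\<lambda>h. G y \<bullet> h)) (at y)" for y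
    unfolding f_def[abs_def] G_def by (rule has_derivative_compose[OF shift barrier_derivative[OF T]])
  have GG': "(G has_derivative G' y) (at y)" for y
    unfolding G_def[abs_def] G'_def by (rule has_derivative_compose[OF shift barrier_grad_derivative[OF T]])
  have "continuous_on UNIV (\<lambda>q. (\<lambda>(y, h). barrier_hess T \<kappa> y h) (fst q - p, snd q))"
    by (rule continuous_on_compose2[OF barrier_hess_continuous[OF T]]) (auto intro!: continuous_intros)
  then have contG': "continuous_on UNIV (\<lambda>(y, h). G' y h)"
    by (simp add: G'_def case_prod_unfold)
  have "C_k_map 2 A u"
    unfolding C_k_map_def
  proof
    fix c assume "c \<in> A"
    then have "C_k_on 2 (chart_image c) (f \<circ> (\<phi> \<circ> chart_inv c))"
      using local_immersion.C_2_compose[OF local_immersion_chart[OF iso] fG GG' contG'] by blast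
    then show "C_k_on 2 (chart_image c) (u \<circ> chart_inv c)"
      by (simp add: u_def[abs_def] o_def)
  qed
  moreover have u_s: "u x * s x \<le> T\<^sup>2" if "x \<in> topspace M" for x
    unfolding u_def f_def s_def using \<kappa> in_cone[OF that] by (intro barrier_upper[OF T]) auto
  have s_T: "s x \<ge> T" for x
    unfolding s_def by (intro real_le_rsqrt) simp
  have "u x \<le> T" if "x \<in> topspace M" for x
  proof (rule ccontr)
    assume "\<not> u x \<le> T"
    then have "T * T < u x * s x"
      using s_T[of x] T by (intro mult_less_le_imp_less) auto
    then show False
      using u_s[OF that] by (simp add: power2_eq_square)
  qed
  then have bdd: "bdd_above (u ` topspace M)"
    by (intro bdd_aboveI2)
  ultimately obtain x where x: "\<And>k. x k \<in> topspace M"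
    and u_x: "\<And>k. k \<ge> 1 \<Longrightarrow> u (x k) > (SUP p\<in>topspace M. u p) - 1 / real k"
    and hess: "\<And>k. k \<ge> 1 \<Longrightarrow> (SUP v\<in>{v \<in> tangent_space A (x k). sqrt (g (x k) v v) = 1}.
                 ereal (hessian A g u (x k) v v)) < ereal (1 / real k)"
    using wmp[of u] by blast
  have "1 \<le> u x0"
    using barrier_lower[OF T v, of "\<phi> x0 - p" \<kappa>] by (simp add: u_def f_def T_def)
  also have "\<dots> \<le> (SUP p\<in>topspace M. u p)"
    using x0 bdd by (rule cSUP_upper)
  finally have sup: "1 \<le> (SUP p\<in>topspace M. u p)" .
  \<comment> \<open>The Hessian bound of \<open>barrier_hess_lower\<close> at
    \<open>s = 2 * T\<^sup>2\<close>, the largest value that \<open>u_s\<close> allows where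
    \<open>u \<ge> 1 / 2\<close>.\<close>
  define \<epsilon> where "\<epsilon> = \<kappa>\<^sup>2 * T\<^sup>2 / (2 * T\<^sup>2) ^ 3"
  have \<epsilon>: "\<epsilon> > 0"
    using \<kappa> T by (simp add: \<epsilon>_def)
  obtain k0 :: nat where k0: "1 / \<epsilon> < real k0"
    using reals_Archimedean2 by blast
  \<comment> \<open>The summand 2 ensures \<open>1 / real k \<le> 1 / 2\<close>, so that
    \<open>u (x k)\<close> stays at least \<open>1 / 2\<close>.\<close>
  define k where "k = k0 + 2"
  have k: "1 / real k \<le> \<epsilon>" "1 / real k \<le> 1 / 2" "k \<ge> 1"
    using k0 \<epsilon> by (auto simp: k_def field_simps)
  have "1 / 2 \<le> u (x k)"
    using u_x[OF k(3)] sup k(2) by linarith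
  then have "1 / 2 * s (x k) \<le> u (x k) * s (x k)"
    using s_T[of "x k"] T by (intro mult_right_mono) auto
  then have s_le: "s (x k) \<le> 2 * T\<^sup>2"
    using u_s[OF x[of k]] by linarith
  \<comment> \<open>The chart in which \<open>hessian\<close> is evaluated by definition, so no
    chart independence of the Hessian has to be shown.\<close>
  define c where "c = chart_at A (x k)"
  define z where "z = chart_map c (x k)"
  have c: "c \<in> A" "x k \<in> chart_dom c"
    unfolding c_def by (intro chart_at x)+
  have z: "z \<in> chart_image c"
    unfolding z_def by (rule chart_map_in_image[OF c(2)])
  interpret L: local_kaehler_immersion "chart_image c" "\<phi> \<circ> chart_inv c" "endo_coord A J c"
    by (rule local_kaehler_immersion_chart[OF iso c(1)])
  have \<psi>z: "(\<phi> \<circ> chart_inv c) z = \<phi> (x k)"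
    by (simp add: z_def chart_inv_chart_map c)
  \<comment> \<open>This excludes \<open>m = 0\<close>, where the subtraction in
    \<open>3 * m - 1\<close> would truncate.\<close>
  have "0 < CARD('n)"
    by simp
  then have dims: "2 * DIM(real ^ 'd) < 3 * DIM(real ^ 'n)"
    using assms(3,4) by simp
  obtain X where X: "norm (L.P z X) = 1"
    and lower: "G' ((\<phi> \<circ> chart_inv c) z) (L.P z X) \<bullet> L.P z X
      \<le> frechet_derivative (\<lambda>z. frechet_derivative (f \<circ> (\<phi> \<circ> chart_inv c)) (at z) X) (at z) X
        - frechet_derivative (f \<circ> (\<phi> \<circ> chart_inv c)) (at z) (L.\<Gamma> z X X)"
    by (rule L.hessian_lower_direction[OF z dims fG GG'])
  let ?V = "coord_vector A c (x k) X"
  have "f \<circ> (\<phi> \<circ> chart_inv c) = u \<circ> chart_inv c"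
    by (simp add: u_def fun_eq_iff)
  with lower have "G' (\<phi> (x k)) (L.P z X) \<bullet> L.P z X \<le> hessian A g u (x k) ?V ?V"
    unfolding \<psi>z by (simp add: hessian_def hessian_coord_def Let_def coord_vector_self[OF c]
        christoffel_eq[OF iso c(1) z] flip: c_def z_def)
  moreover have "\<kappa>\<^sup>2 * T\<^sup>2 / s (x k) ^ 3 \<le> G' (\<phi> (x k)) (L.P z X) \<bullet> L.P z X"
    using barrier_hess_lower[OF T, of \<kappa> "\<phi> (x k) - p" "L.P z X"] X
    by (simp add: G'_def s_def norm_eq_1)
  moreover have "\<epsilon> \<le> \<kappa>\<^sup>2 * T\<^sup>2 / s (x k) ^ 3"
    unfolding \<epsilon>_def using s_le s_T[of "x k"] T
    by (intro divide_left_mono power_mono mult_pos_pos zero_less_power) auto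
  ultimately have "1 / real k \<le> hessian A g u (x k) ?V ?V"
    using k(1) by linarith
  moreover have "sqrt (g (x k) ?V ?V) = 1"
    using chart_derivative_inner[OF iso c, of X X] X by (simp add: L.P_def norm_eq_1 z_def)
  then have "ereal (hessian A g u (x k) ?V ?V) \<le> (SUP v\<in>{v \<in> tangent_space A (x k). sqrt (g (x k) v v) = 1}.
                 ereal (hessian A g u (x k) v v))"
    using coord_vector_tangent[OF c] by (intro SUP_upper) auto
  then have "ereal (hessian A g u (x k) ?V ?V) < ereal (1 / real k)"
    using hess[OF k(3)] by (rule le_less_trans)
  ultimately show False
    by simp
qed

end
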